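(* On $\mathcal F_{n,\bullet}=\bigoplus_{g=0}^n\mathcal F_{n,g}$ the operators $\Lambda,\Delta,H$ form an $\mathfrak{sl}_2$-triple, i.e. \[[\Lambda,\Delta]=H,\qquad[H,\Lambda]=2\Lambda,\qquad[H,\Delta]=-2\Delta .\]
   Context: $\mathcal F_{n,g}$ ($1\le g\le n$) is the space of functions $P:M_{n\times g}(\mathbb C)\to\mathbb C$, polynomial in the entries and their conjugates, with $P(UA)=|\det A|^2P(U)$ for all $A\in M_g(\mathbb C)$; $\mathcal F_{n,0}=\mathbb C$. Columns $U=(\lambda_1,\dots,\lambda_g)$, $\lambda_i\in\mathbb C^n$; derivatives are Wirtinger derivatives. Lowering operator $\Delta$: on $\mathcal F_{n,0}$ it is $0$; on $\mathcal F_{n,g}$, $g\ge1$, it is $\Delta_g=\sum_{s=1}^n\partial^2/\partial\lambda_g^{(s)}\partial\overline{\lambda_g^{(s)}}$, whose result is independent of $\lambda_g$ and is regarded as an element of $\mathcal F_{n,g-1}$ in $(\lambda_1,\dots,\lambda_{g-1})$. Raising operator $\Lambda:\mathcal F_{n,g-1}\to\mathcal F_{n,g}$ ($1\le g\le n$): with $m_{ii}=P(\lambda_1,\dots,\widehat{\lambda_i},\dots,\lambda_g)$, $m_{ij}=-\sum_s\lambda_i^{(s)}\partial m_{ii}/\partial\lambda_j^{(s)}$ ($i\ne j$) and $h(x,y)=\sum_sx^{(s)}\overline{y^{(s)}}$, set $\Lambda(P)=\sum_{k,\ell=1}^gh(\lambda_k,\lambda_\ell)m_{\ell k}$; $\Lambda$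 is $0$ on $\mathcal F_{n,n}$. $H$ acts on $\mathcal F_{n,g}$ by $H=-n+\sum_{i=1}^g\big(\sum_s\lambda_i^{(s)}\partial/\partial\lambda_i^{(s)}+\sum_s\overline{\lambda_i^{(s)}}\partial/\partial\overline{\lambda_i^{(s)}}\big)$. *)

theory Defs
  imports "HOL-Analysis.Derivative" "Jordan_Normal_Form.Determinant"
begin

text \<open>
  An element \<open>U\<close> of \<open>carrier_mat n g\<close> has the columns \<open>\<lambda>\<^sub>1, \<dots>, \<lambda>\<^sub>g\<close>, indexed from \<open>0\<close>:
  \<open>U $$ (s, i)\<close> is the coordinate \<open>s + 1\<close> of \<open>\<lambda>\<close> with index \<open>i + 1\<close>.
  Functions on \<open>n \<times> g\<close> matrices are represented by functions on all complex matrices that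
  vanish off \<open>carrier_mat n g\<close>, so that equality of functions is equality in HOL.
\<close>

definition on_mat :: "nat \<Rightarrow> nat \<Rightarrow> (complex mat \<Rightarrow> complex) \<Rightarrow> complex mat \<Rightarrow> complex" where
  "on_mat n g f = (\<lambda>U. if U \<in> carrier_mat n g then f U else 0)"

inductive_set poly_funs :: "nat \<Rightarrow> nat \<Rightarrow> (complex mat \<Rightarrow> complex) set" for n g :: nat where
  const: "(\<lambda>U. c) \<in> poly_funs n g"
| entry: "s < n \<Longrightarrow> i < g \<Longrightarrow> (\<lambda>U. U $$ (s, i)) \<in> poly_funs n g"
| cnj_entry: "s < n \<Longrightarrow> i < g \<Longrightarrow> (\<lambda>U. cnj (U $$ (s, i))) \<in> poly_funs n g"
| add: "p \<in> poly_funs n g \<Longrightarrow> q \<in> poly_funs n g \<Longrightarrow> (\<lambda>U. p U + q U) \<in> poly_funs n g"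
| mult: "p \<in> poly_funs n g \<Longrightarrow> q \<in> poly_funs n g \<Longrightarrow> (\<lambda>U. p U * q U) \<in> poly_funs n g"

definition \<F> :: "nat \<Rightarrow> nat \<Rightarrow> (complex mat \<Rightarrow> complex) set" where
  "\<F> n g = {P. (\<exists>p \<in> poly_funs n g. P = on_mat n g p) \<and>
     (\<forall>U \<in> carrier_mat n g. \<forall>A \<in> carrier_mat g g.
        P (U * A) = of_real ((cmod (det A))\<^sup>2) * P U)}"

lemma F_0: "\<F> n 0 = range (\<lambda>c. on_mat n 0 (\<lambda>U. c))"
proof
  have "\<exists>c. p = (\<lambda>U. c)" if "p \<in> poly_funs n 0" for p
    using that by induction auto
  then show "\<F> n 0 \<subseteq> range (\<lambda>c. on_mat n 0 (\<lambda>U. c))"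
    unfolding \<F>_def by blast
  show "range (\<lambda>c. on_mat n 0 (\<lambda>U. c)) \<subseteq> \<F> n 0"
    by (auto simp: \<F>_def on_mat_def det_dim_zero intro: poly_funs.const)
qed

text \<open>The direct sum of the \<open>\<F> n g\<close> for \<open>0 \<le> g \<le> n\<close>, as families of components.\<close>

definition \<F>sum :: "nat \<Rightarrow> (nat \<Rightarrow> complex mat \<Rightarrow> complex) set" where
  "\<F>sum n = {P. (\<forall>g\<le>n. P g \<in> \<F> n g) \<and> (\<forall>g>n. P g = (\<lambda>U. 0))}"

text \<open>Wirtinger derivatives with respect to the entry \<open>(s, i)\<close> and to its conjugate.\<close>

definition shift_entry :: "nat \<Rightarrow> nat \<Rightarrow> complex \<Rightarrow> complex mat \<Rightarrow> complex mat" where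
  "shift_entry s i w U =
     mat (dim_row U) (dim_col U) (\<lambda>(r, c). if r = s \<and> c = i then U $$ (r, c) + w else U $$ (r, c))"

definition partial_re :: "nat \<Rightarrow> nat \<Rightarrow> (complex mat \<Rightarrow> complex) \<Rightarrow> complex mat \<Rightarrow> complex" where
  "partial_re s i f U = vector_derivative (\<lambda>t::real. f (shift_entry s i (of_real t) U)) (at 0)"

definition partial_im :: "nat \<Rightarrow> nat \<Rightarrow> (complex mat \<Rightarrow> complex) \<Rightarrow> complex mat \<Rightarrow> complex" where
  "partial_im s i f U = vector_derivative (\<lambda>t::real. f (shift_entry s i (\<i> * of_real t) U)) (at 0)"

definition wirt :: "nat \<Rightarrow> nat \<Rightarrow> (complex mat \<Rightarrow> complex) \<Rightarrow> complex mat \<Rightarrow> complex" where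
  "wirt s i f U = (partial_re s i f U - \<i> * partial_im s i f U) / 2"

definition wirt_bar :: "nat \<Rightarrow> nat \<Rightarrow> (complex mat \<Rightarrow> complex) \<Rightarrow> complex mat \<Rightarrow> complex" where
  "wirt_bar s i f U = (partial_re s i f U + \<i> * partial_im s i f U) / 2"

definition delete_col :: "nat \<Rightarrow> complex mat \<Rightarrow> complex mat" where
  "delete_col i U = mat (dim_row U) (dim_col U - 1) (\<lambda>(s, j). U $$ (s, if j < i then j else Suc j))"

definition append_zero_col :: "complex mat \<Rightarrow> complex mat" where
  "append_zero_col V =
     mat (dim_row V) (Suc (dim_col V)) (\<lambda>(s, j). if j < dim_col V then V $$ (s, j) else 0)"

definition last_laplacian :: "nat \<Rightarrow> nat \<Rightarrow> (complex mat \<Rightarrow> complex) \<Rightarrow> complex mat \<Rightarrow> complex" where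
  "last_laplacian n g P U = (\<Sum>s<n. wirt s g (wirt_bar s g P) U)"

text \<open>
  \<open>lower n g\<close> maps \<open>\<F> n (Suc g)\<close> to \<open>\<F> n g\<close>. On \<open>\<F> n (Suc g)\<close> the Laplacian in the last column
  does not depend on that column, so its value at a zero last column gives the function of the
  remaining columns.
\<close>

definition lower :: "nat \<Rightarrow> nat \<Rightarrow> (complex mat \<Rightarrow> complex) \<Rightarrow> complex mat \<Rightarrow> complex" where
  "lower n g P = on_mat n g (\<lambda>V. last_laplacian n g P (append_zero_col V))"

definition herm :: "nat \<Rightarrow> complex mat \<Rightarrow> nat \<Rightarrow> nat \<Rightarrow> complex" where
  "herm n U k l = (\<Sum>s<n. U $$ (s, k) * cnj (U $$ (s, l)))"

definition m_coeff :: "nat \<Rightarrow> (complex mat \<Rightarrow> complex) \<Rightarrow> nat \<Rightarrow> nat \<Rightarrow> complex mat \<Rightarrow> complex" where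
  "m_coeff n P i j U =
     (if i = j then P (delete_col i U)
      else - (\<Sum>s<n. U $$ (s, i) * wirt s j (\<lambda>W. P (delete_col i W)) U))"

text \<open>\<open>raise n g\<close> maps \<open>\<F> n g\<close> to \<open>\<F> n (Suc g)\<close> when \<open>g < n\<close>.\<close>

definition raise :: "nat \<Rightarrow> nat \<Rightarrow> (complex mat \<Rightarrow> complex) \<Rightarrow> complex mat \<Rightarrow> complex" where
  "raise n g P = on_mat n (Suc g)
     (\<lambda>U. \<Sum>k<Suc g. \<Sum>l<Suc g. herm n U k l * m_coeff n P l k U)"

definition weight :: "nat \<Rightarrow> nat \<Rightarrow> (complex mat \<Rightarrow> complex) \<Rightarrow> complex mat \<Rightarrow> complex" where
  "weight n g P = on_mat n g
     (\<lambda>U. - of_nat n * P U +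
        (\<Sum>i<g. (\<Sum>s<n. U $$ (s, i) * wirt s i P U) + (\<Sum>s<n. cnj (U $$ (s, i)) * wirt_bar s i P U)))"

definition Lambda_op ::
    "nat \<Rightarrow> (nat \<Rightarrow> complex mat \<Rightarrow> complex) \<Rightarrow> nat \<Rightarrow> complex mat \<Rightarrow> complex" where
  "Lambda_op n P g =
     (case g of 0 \<Rightarrow> (\<lambda>U. 0) | Suc k \<Rightarrow> if k < n then raise n k (P k) else (\<lambda>U. 0))"

definition Delta_op ::
    "nat \<Rightarrow> (nat \<Rightarrow> complex mat \<Rightarrow> complex) \<Rightarrow> nat \<Rightarrow> complex mat \<Rightarrow> complex" where
  "Delta_op n P g = (if g < n then lower n g (P (Suc g)) else (\<lambda>U. 0))"

definition H_op ::
    "nat \<Rightarrow> (nat \<Rightarrow> complex mat \<Rightarrow> complex) \<Rightarrow> nat \<Rightarrow> complex mat \<Rightarrow> complex" where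
  "H_op n P g = weight n g (P g)"

definition linear_operator ::
    "nat \<Rightarrow> ((nat \<Rightarrow> complex mat \<Rightarrow> complex) \<Rightarrow> nat \<Rightarrow> complex mat \<Rightarrow> complex) \<Rightarrow> bool" where
  "linear_operator n T \<longleftrightarrow>
     (\<forall>P \<in> \<F>sum n. T P \<in> \<F>sum n) \<and>
     (\<forall>P \<in> \<F>sum n. \<forall>Q \<in> \<F>sum n. \<forall>a b.
        T (\<lambda>g U. a * P g U + b * Q g U) = (\<lambda>g U. a * T P g U + b * T Q g U))"

definition commutator ::
    "((nat \<Rightarrow> complex mat \<Rightarrow> complex) \<Rightarrow> nat \<Rightarrow> complex mat \<Rightarrow> complex) \<Rightarrow>
     ((nat \<Rightarrow> complex mat \<Rightarrow> complex) \<Rightarrow> nat \<Rightarrow> complex mat \<Rightarrow> complex) \<Rightarrow>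
     (nat \<Rightarrow> complex mat \<Rightarrow> complex) \<Rightarrow> nat \<Rightarrow> complex mat \<Rightarrow> complex" where
  "commutator S T P = (\<lambda>g U. S (T P) g U - T (S P) g U)"

end

theory Submission
  imports Defs
begin

text \<open>
  Polarising \<open>P \<in> \<F> n g\<close> to a polynomial \<open>q(U, V)\<close> with \<open>P(U) = q(U, cnj U)\<close>, the equivariance
  extends to \<open>q(U A, V B) = det A det B q(U, V)\<close>, because the points \<open>V = cnj U\<close>, \<open>B = cnj A\<close> are
  Zariski dense. Hence \<open>q\<close> is multilinear and alternating in the columns of \<open>U\<close> and of \<open>V\<close>, so
  \<open>\<F> n g\<close> is spanned by the functions \<open>det (X U) cnj (det (Y U))\<close>. On these, with \<open>\<epsilon>\<^sub>s\<close> the wedge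
  product with the coordinate form \<open>s\<close> and \<open>\<iota>\<^sub>s\<close> the contraction with the basis vector \<open>s\<close>,
  \<open>\<Lambda>(f cnj h) = \<Sum>\<^sub>s \<epsilon>\<^sub>s f cnj (\<epsilon>\<^sub>s h)\<close> and \<open>\<Delta>(f cnj h) = \<Sum>\<^sub>s \<iota>\<^sub>s f cnj (\<iota>\<^sub>s h)\<close>. The
  relations \<open>\<iota>\<^sub>s \<epsilon>\<^sub>r = (-1)\<^sup>g \<delta>\<^sub>r\<^sub>s + \<epsilon>\<^sub>r \<iota>\<^sub>s\<close> and \<open>\<Sum>\<^sub>s \<epsilon>\<^sub>s \<iota>\<^sub>s = - (-1)\<^sup>g g\<close> then give
  \<open>[\<Lambda>, \<Delta>] = 2 g - n\<close>, which is the scalar by which \<open>H\<close> acts.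
\<close>

section \<open>Polynomial functions of complex variables\<close>

text \<open>The index type is left arbitrary because the variables range over several things below:
  the coordinates of one column, the entries of one or two matrices, and the real and imaginary
  parts of matrices.\<close>

inductive_set pol :: "'v set \<Rightarrow> (('v \<Rightarrow> complex) \<Rightarrow> complex) set" for S :: "'v set" where
  const: "(\<lambda>x. c) \<in> pol S"
| var: "v \<in> S \<Longrightarrow> (\<lambda>x. x v) \<in> pol S"
| add: "f \<in> pol S \<Longrightarrow> h \<in> pol S \<Longrightarrow> (\<lambda>x. f x + h x) \<in> pol S"
| mult: "f \<in> pol S \<Longrightarrow> h \<in> pol S \<Longrightarrow> (\<lambda>x. f x * h x) \<in> pol S"

lemma pol_diff: "f \<in> pol S \<Longrightarrow> h \<in> pol S \<Longrightarrow> (\<lambda>x. f x - h x) \<in> pol S"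
proof -
  assume "f \<in> pol S" "h \<in> pol S"
  then have "(\<lambda>x. f x + (-1) * h x) \<in> pol S" by (intro pol.intros)
  then show ?thesis by simp
qed

lemma pol_if:
  "(b \<Longrightarrow> f \<in> pol S) \<Longrightarrow> (\<not> b \<Longrightarrow> h \<in> pol S) \<Longrightarrow> (\<lambda>x. if b then f x else h x) \<in> pol S"
  by (cases b) auto

lemma pol_sum:
  assumes "\<And>i. i \<in> I \<Longrightarrow> (\<lambda>x. f i x) \<in> pol S"
  shows "(\<lambda>x. \<Sum>i\<in>I. f i x) \<in> pol S"
  using assms
  by (induction I rule: infinite_finite_induct) (auto intro: pol.const pol.add)

lemma pol_prod:
  assumes "\<And>i. i \<in> I \<Longrightarrow> (\<lambda>x. f i x) \<in> pol S"
  shows "(\<lambda>x. \<Prod>i\<in>I. f i x) \<in> pol S"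
  using assms
  by (induction I rule: infinite_finite_induct) (auto intro: pol.const pol.mult)

lemma pol_subst:
  assumes "f \<in> pol S" and "\<And>v. v \<in> S \<Longrightarrow> (\<lambda>x. \<phi> x v) \<in> pol T"
  shows "(\<lambda>x. f (\<phi> x)) \<in> pol T"
  using assms(1) by induction (auto intro: pol.intros assms(2))

lemma pol_det:
  assumes "\<And>i j. i < m \<Longrightarrow> j < m \<Longrightarrow> (\<lambda>x. a x i j) \<in> pol S"
  shows "(\<lambda>x. det (mat m m (\<lambda>(i, j). a x i j))) \<in> pol S"
proof -
  have "(\<lambda>x. det (mat m m (\<lambda>(i, j). a x i j)))
      = (\<lambda>x. \<Sum>p | p permutes {0..<m}. of_int (sign p) * (\<Prod>i = 0..<m. a x i (p i)))"
    by (intro ext, subst det_def'[of _ m]) (auto intro!: sum.cong prod.cong)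
  then show ?thesis
    by (auto intro!: pol_sum pol.mult pol.const pol_prod assms)
qed

text \<open>Varying a single coordinate reduces vanishing questions to the finiteness of the root
  set of a univariate polynomial.\<close>

lemma pol_univariate:
  assumes "f \<in> pol S"
  shows "\<exists>p. \<forall>t. f (x(v := t)) = poly p t"
  using assms
proof induction
  case (const c)
  show ?case by (rule exI[of _ "[:c:]"]) simp
next
  case (var w)
  show ?case by (rule exI[of _ "if w = v then [:0, 1:] else [:x w:]"]) simp
next
  case (add f h)
  then obtain p q where "\<forall>t. f (x(v := t)) = poly p t" "\<forall>t. h (x(v := t)) = poly q t" by blast
  then show ?case by (intro exI[of _ "p + q"] allI) (simp only: poly_add)
next
  case (mult f h)
  then obtain p q where "\<forall>t. f (x(v := t)) = poly p t" "\<forall>t. h (x(v := t)) = poly q t" by blast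
  then show ?case by (intro exI[of _ "p * q"] allI) (simp only: poly_mult)
qed

text \<open>Zariski density of the real points: the variables are released from being real one at a
  time, and a univariate polynomial with infinitely many real zeros is 0.\<close>

lemma pol_eq_0_of_real_points:
  assumes "finite S" and f: "f \<in> pol S"
    and real: "\<And>x. (\<And>v. v \<in> S \<Longrightarrow> x v \<in> \<real>) \<Longrightarrow> f x = 0"
  shows "f x = 0"
proof -
  \<comment> \<open>\<open>T\<close> is the set of variables already allowed to be non-real; the
    claim is the case \<open>T = S\<close>.\<close>
  have "\<forall>x. (\<forall>v\<in>S - T. x v \<in> \<real>) \<longrightarrow> f x = 0" if "finite T" for T
    using that
  proof induction
    case empty
    then show ?case using real by simp
  next
    case (insert v T)
    show ?case
    proof (intro allI impI)
      fix x :: "'a \<Rightarrow> complex"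
      assume x: "\<forall>w\<in>S - insert v T. x w \<in> \<real>"
      obtain p where p: "\<And>t. f (x(v := t)) = poly p t"
        using pol_univariate[OF f] by blast
      have "poly p t = 0" if "t \<in> \<real>" for t
      proof -
        have "\<forall>w\<in>S - T. (x(v := t)) w \<in> \<real>" using x that by simp
        then have "f (x(v := t)) = 0" using insert.IH by blast
        then show ?thesis by (simp add: p)
      qed
      then have "\<real> \<subseteq> {t. poly p t = 0}" by auto
      moreover have "infinite (\<real> :: complex set)"
        unfolding Reals_def
        using finite_imageD[of complex_of_real UNIV] infinite_UNIV_char_0[where 'a = real]
        by (auto simp: inj_def)
      ultimately have "p = 0"
        by (metis finite_subset poly_roots_finite)
      then show "f x = 0" using p[of "x v"] by simp
    qed
  qed
  from this[OF \<open>finite S\<close>] show ?thesis by simp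
qed

text \<open>Taylor expansion to first order along the ray through \<open>x\<close>. The constant
  \<open>c\<close> and the linear form \<open>l\<close> do not depend on \<open>x\<close>, whereas
  the remainder \<open>p\<close> may.\<close>

lemma pol_linear_part:
  assumes "f \<in> pol S" "finite S"
  shows "\<exists>c l. \<forall>x. \<exists>p. \<forall>t. f (\<lambda>v. t * x v) = poly (pCons c (pCons (\<Sum>v\<in>S. x v * l v) p)) t"
  using assms(1)
proof induction
  case (const c)
  show ?case by (intro exI[of _ c] exI[of _ "\<lambda>v. 0"] allI exI[of _ "0"]) simp
next
  case (var w)
  show ?case
    by (intro exI[of _ 0] exI[of _ "\<lambda>v. if v = w then 1 else 0"] allI exI[of _ "0"])
      (use var assms(2) in \<open>simp add: if_distrib[of "(*) _"] sum.delta cong: if_cong\<close>)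
next
  case (add f h)
  then obtain c l d k where
    1: "\<And>x. \<exists>p. \<forall>t. f (\<lambda>v. t * x v) = poly (pCons c (pCons (\<Sum>v\<in>S. x v * l v) p)) t" and
    2: "\<And>x. \<exists>p. \<forall>t. h (\<lambda>v. t * x v) = poly (pCons d (pCons (\<Sum>v\<in>S. x v * k v) p)) t" by blast
  show ?case
  proof (intro exI[of _ "c + d"] exI[of _ "\<lambda>v. l v + k v"] allI)
    fix x
    obtain p q where "\<And>t. f (\<lambda>v. t * x v) = poly (pCons c (pCons (\<Sum>v\<in>S. x v * l v) p)) t"
      "\<And>t. h (\<lambda>v. t * x v) = poly (pCons d (pCons (\<Sum>v\<in>S. x v * k v) q)) t"
      using 1 2 by metis
    then show "\<exists>p. \<forall>t. f (\<lambda>v. t * x v) + h (\<lambda>v. t * x v) =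
        poly (pCons (c + d) (pCons (\<Sum>v\<in>S. x v * (l v + k v)) p)) t"
      by (intro exI[of _ "p + q"]) (simp add: algebra_simps sum.distrib)
  qed
next
  case (mult f h)
  then obtain c l d k where
    1: "\<And>x. \<exists>p. \<forall>t. f (\<lambda>v. t * x v) = poly (pCons c (pCons (\<Sum>v\<in>S. x v * l v) p)) t" and
    2: "\<And>x. \<exists>p. \<forall>t. h (\<lambda>v. t * x v) = poly (pCons d (pCons (\<Sum>v\<in>S. x v * k v) p)) t" by blast
  show ?case
  proof (intro exI[of _ "c * d"] exI[of _ "\<lambda>v. c * k v + d * l v"] allI)
    fix x
    let ?L = "\<Sum>v\<in>S. x v * l v" and ?K = "\<Sum>v\<in>S. x v * k v"
    obtain p q where pq: "\<And>t. f (\<lambda>v. t * x v) = poly (pCons c (pCons ?L p)) t"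
      "\<And>t. h (\<lambda>v. t * x v) = poly (pCons d (pCons ?K q)) t"
      using 1 2 by metis
    have "(\<Sum>v\<in>S. x v * (c * k v + d * l v)) = c * ?K + d * ?L"
      by (simp add: algebra_simps sum.distrib sum_distrib_left)
    then show "\<exists>p. \<forall>t. f (\<lambda>v. t * x v) * h (\<lambda>v. t * x v) =
        poly (pCons (c * d) (pCons (\<Sum>v\<in>S. x v * (c * k v + d * l v)) p)) t"
      \<comment> \<open>The witness collects the terms of order at least 2 in the product of
        \<open>c + L t + p t^2\<close> and \<open>d + K t + q t^2\<close>, divided by
        \<open>t^2\<close>.\<close>
      by (intro exI[of _ "smult c q + smult d p + [:?L * ?K:] + [:0, 1:] * (smult ?L q + smult ?K p + [:0, 1:] * (p * q))"])
        (simp add: pq algebra_simps)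
  qed
qed

text \<open>Comparing coefficients in \<open>f (t x) = t f x\<close> leaves only the linear part of
  \<open>f\<close>, whose coefficients are read off at the unit vectors.\<close>

lemma pol_homogeneous_linear:
  assumes f: "f \<in> pol S" "finite S" and hom: "\<And>t x. f (\<lambda>v. t * x v) = t * f x"
  shows "f x = (\<Sum>v\<in>S. x v * f (\<lambda>w. if w = v then 1 else 0))"
proof -
  obtain c l where
    *: "\<And>x. \<exists>p. \<forall>t. f (\<lambda>v. t * x v) = poly (pCons c (pCons (\<Sum>v\<in>S. x v * l v) p)) t"
    using pol_linear_part[OF f] by blast
  have lin: "f x = (\<Sum>v\<in>S. x v * l v)" for x
  proof -
    obtain p where p: "\<And>t. f (\<lambda>v. t * x v) = poly (pCons c (pCons (\<Sum>v\<in>S. x v * l v) p)) t"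
      using * by blast
    have "poly [:0, f x:] = poly (pCons c (pCons (\<Sum>v\<in>S. x v * l v) p))"
      using p hom by (auto simp: fun_eq_iff)
    then show ?thesis
      by (simp only: poly_eq_poly_eq_iff pCons_eq_iff)
  qed
  have "f (\<lambda>w. if w = v then 1 else 0) = l v" if "v \<in> S" for v
    using that f(2) by (simp add: lin if_distrib[of "\<lambda>a. a * _"] sum.delta cong: if_cong)
  then show ?thesis by (subst lin) simp
qed

text \<open>Entries and their conjugates become independent variables of \<open>q\<close>, tagged
  \<open>False\<close> and \<open>True\<close> respectively.\<close>

lemma poly_funs_polarise:
  assumes "p \<in> poly_funs n g"
  shows "\<exists>q \<in> pol (UNIV \<times> {..<n} \<times> {..<g}).
    \<forall>U. p U = q (\<lambda>(b, si). if b then cnj (U $$ si) else U $$ si)"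
  using assms
proof induction
  case (const c)
  show ?case by (intro bexI[OF _ pol.const[of c]]) simp
next
  case (entry s i)
  then show ?case by (intro bexI[OF _ pol.var[of "(False, s, i)"]]) auto
next
  case (cnj_entry s i)
  then show ?case by (intro bexI[OF _ pol.var[of "(True, s, i)"]]) auto
next
  case (add p q)
  then obtain p' q' where "p' \<in> pol (UNIV \<times> {..<n} \<times> {..<g})" "q' \<in> pol (UNIV \<times> {..<n} \<times> {..<g})"
    "\<forall>U. p U = p' (\<lambda>(b, si). if b then cnj (U $$ si) else U $$ si)"
    "\<forall>U. q U = q' (\<lambda>(b, si). if b then cnj (U $$ si) else U $$ si)" by blast
  then show ?case by (intro bexI[OF _ pol.add[of p' _ q']]) auto
next
  case (mult p q)
  then obtain p' q' where "p' \<in> pol (UNIV \<times> {..<n} \<times> {..<g})" "q' \<in> pol (UNIV \<times> {..<n} \<times> {..<g})"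
    "\<forall>U. p U = p' (\<lambda>(b, si). if b then cnj (U $$ si) else U $$ si)"
    "\<forall>U. q U = q' (\<lambda>(b, si). if b then cnj (U $$ si) else U $$ si)" by blast
  then show ?case by (intro bexI[OF _ pol.mult[of p' _ q']]) auto
qed

section \<open>Polarisation and alternating functions\<close>

lemma comm_ring_hom_cnj: "comm_ring_hom cnj"
  by unfold_locales auto

lemma map_mat_cnj_mult:
  assumes "A \<in> carrier_mat m l" "B \<in> carrier_mat l k"
  shows "map_mat cnj (A * B) = map_mat cnj A * map_mat cnj B"
proof -
  interpret comm_ring_hom cnj by (rule comm_ring_hom_cnj)
  show ?thesis by (rule mat_hom_mult[OF assms])
qed

lemma det_map_mat_cnj: "det (map_mat cnj A) = cnj (det A)"
proof -
  interpret comm_ring_hom cnj by (rule comm_ring_hom_cnj)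
  show ?thesis by simp
qed

lemma mult_index_sum:
  assumes "A \<in> carrier_mat m l" "B \<in> carrier_mat l k" "i < m" "j < k"
  shows "(A * B) $$ (i, j) = (\<Sum>r<l. A $$ (i, r) * B $$ (r, j))"
  using assms by (simp add: scalar_prod_def atLeast0LessThan)

text \<open>Matrix entries outside the carrier dimensions are unspecified; this lets assignments
  that differ only there be exchanged.\<close>

lemma pol_cong:
  assumes "f \<in> pol S" "\<And>v. v \<in> S \<Longrightarrow> x v = y v"
  shows "f x = f y"
  using assms(1) by induction (auto simp: assms(2))

definition mat_pair :: "complex mat \<Rightarrow> complex mat \<Rightarrow> bool \<times> nat \<times> nat \<Rightarrow> complex" where
  "mat_pair U V = (\<lambda>(b, si). if b then V $$ si else U $$ si)"

text \<open>The difference of the two sides is polynomial in matrices \<open>a\<close>,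
  \<open>b\<close>, \<open>a'\<close>, \<open>b'\<close> once \<open>U = a + \<i> b\<close>,
  \<open>V = a - \<i> b\<close>, \<open>A = a' + \<i> b'\<close>, \<open>B = a' - \<i> b'\<close>.
  At real points \<open>V\<close> and \<open>B\<close> are the conjugates of \<open>U\<close> and
  \<open>A\<close>, so \<open>equi\<close> makes it vanish there, hence everywhere.\<close>

lemma polarised_equivariance:
  fixes n g :: nat
  assumes q: "q \<in> pol (UNIV \<times> {..<n} \<times> {..<g})"
    and equi: "\<And>U A. U \<in> carrier_mat n g \<Longrightarrow> A \<in> carrier_mat g g \<Longrightarrow>
      q (mat_pair (U * A) (map_mat cnj (U * A)))
        = det A * cnj (det A) * q (mat_pair U (map_mat cnj U))"
    and U: "U \<in> carrier_mat n g" and V: "V \<in> carrier_mat n g"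
    and A: "A \<in> carrier_mat g g" and B: "B \<in> carrier_mat g g"
  shows "q (mat_pair (U * A) (V * B)) = det A * det B * q (mat_pair U V)"
proof -
  \<comment> \<open>Four layers of size \<open>N\<close>, large enough for both shapes: layers 0 and
    1 carry the parts of \<open>U\<close> and \<open>V\<close>, layers 2 and 3 those of
    \<open>A\<close> and \<open>B\<close>. \<open>M\<close> with \<open>c = \<i>\<close> assembles
    \<open>U\<close> and \<open>A\<close>, with \<open>c = -\<i>\<close> it assembles
    \<open>V\<close> and \<open>B\<close>.\<close>
  define N where "N = max n g"
  define S where "S = {..<4::nat} \<times> {..<N} \<times> {..<N}"
  define M where "M = (\<lambda>(x :: nat \<times> nat \<times> nat \<Rightarrow> complex) c k m l.
    mat m l (\<lambda>(i, j). x (k, i, j) + c * x (Suc k, i, j)))"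
  define F where "F = (\<lambda>x. q (mat_pair (M x \<i> 0 n g * M x \<i> 2 g g) (M x (-\<i>) 0 n g * M x (-\<i>) 2 g g))
    - det (M x \<i> 2 g g) * det (M x (-\<i>) 2 g g) * q (mat_pair (M x \<i> 0 n g) (M x (-\<i>) 0 n g)))"
  have M_carrier [simp]: "M x c k m l \<in> carrier_mat m l" for x c k m l
    by (simp add: M_def)
  have entry: "(\<lambda>x. x (k, i, j) + c * x (Suc k, i, j)) \<in> pol S"
    if "Suc k < 4" "i < N" "j < N" for c k i j
    using that by (auto intro!: pol.intros simp: S_def)
  have M_entry: "(\<lambda>x. M x c k m l $$ (i, j)) \<in> pol S"
    if "Suc k < 4" "m \<le> N" "l \<le> N" "i < m" "j < l" for c k m l i j
    using entry[of k i j c] that by (simp add: M_def)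
  have M_det: "(\<lambda>x. det (M x c k g g)) \<in> pol S" if "Suc k < 4" for c k
    unfolding M_def by (rule pol_det) (use entry that in \<open>auto simp: N_def\<close>)
  have M_mult: "(\<lambda>x. (M x c 0 n g * M x c 2 g g) $$ (i, j)) \<in> pol S" if "i < n" "j < g" for c i j
  proof -
    have "(\<lambda>x. (M x c 0 n g * M x c 2 g g) $$ (i, j))
        = (\<lambda>x. \<Sum>r<g. M x c 0 n g $$ (i, r) * M x c 2 g g $$ (r, j))"
      using that by (intro ext mult_index_sum) auto
    then show ?thesis
      using that by (auto intro!: pol_sum pol.mult M_entry simp: N_def)
  qed
  have F: "F \<in> pol S"
    unfolding F_def
    by (intro pol_diff pol.mult M_det pol_subst[OF q])
      (auto simp: mat_pair_def N_def intro!: pol_if M_mult M_entry)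
  have F_0: "F x = 0" for x
  proof (rule pol_eq_0_of_real_points[OF _ F])
    show "finite S" by (simp add: S_def)
    fix x :: "nat \<times> nat \<times> nat \<Rightarrow> complex"
    assume "\<And>v. v \<in> S \<Longrightarrow> x v \<in> \<real>"
    then have cnj: "M x (-\<i>) k m l = map_mat cnj (M x \<i> k m l)"
      if "Suc k < 4" "m \<le> N" "l \<le> N" for k m l
      using that by (intro eq_matI) (auto simp: M_def S_def Reals_cnj_iff)
    have "M x (-\<i>) 0 n g = map_mat cnj (M x \<i> 0 n g)" "M x (-\<i>) 2 g g = map_mat cnj (M x \<i> 2 g g)"
      by (auto intro!: cnj simp: N_def)
    then show "F x = 0"
      unfolding F_def by (simp add: map_mat_cnj_mult[symmetric, of _ n g _ g] det_map_mat_cnj equi)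
  qed
  \<comment> \<open>Solving the substitution for the layers shows that every quadruple
    \<open>U\<close>, \<open>V\<close>, \<open>A\<close>, \<open>B\<close> is reached.\<close>
  define x where "x = (\<lambda>(k::nat, i, j). if k = 0 then (U $$ (i, j) + V $$ (i, j)) / 2
     else if k = 1 then (U $$ (i, j) - V $$ (i, j)) / (2 * \<i>)
     else if k = 2 then (A $$ (i, j) + B $$ (i, j)) / 2
     else (A $$ (i, j) - B $$ (i, j)) / (2 * \<i>))"
  have "M x \<i> 0 n g = U" "M x (-\<i>) 0 n g = V" "M x \<i> 2 g g = A" "M x (-\<i>) 2 g g = B"
    using U V A B by (auto intro!: eq_matI simp: M_def x_def field_simps)
  then show ?thesis using F_0[of x] by (simp add: F_def)
qed

section \<open>Expansion of alternating polynomials in minors\<close>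

definition unit_col :: "nat \<Rightarrow> nat \<Rightarrow> complex mat \<Rightarrow> complex mat" where
  "unit_col s i U = mat (dim_row U) (dim_col U)
     (\<lambda>(r, c). if c = i then (if r = s then 1 else 0) else U $$ (r, c))"

text \<open>Left multiplication by it picks the rows \<open>I 0, ..., I (g - 1)\<close>, so
  \<open>det (row_select n g I * U)\<close> is a minor of \<open>U\<close>; the columns of its
  transpose are the corresponding basis vectors.\<close>

definition row_select :: "nat \<Rightarrow> nat \<Rightarrow> (nat \<Rightarrow> nat) \<Rightarrow> complex mat" where
  "row_select n g I = mat g n (\<lambda>(i, s). if s = I i then 1 else 0)"

lemma sum_PiE_lessThan_Suc:
  fixes f :: "(nat \<Rightarrow> nat) \<Rightarrow> complex"
  shows "(\<Sum>I \<in> {..<Suc m} \<rightarrow>\<^sub>E {..<n}. f I) = (\<Sum>I \<in> {..<m} \<rightarrow>\<^sub>E {..<n}. \<Sum>r<n. f (I(m := r)))"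
proof -
  have "(\<Sum>I \<in> {..<Suc m} \<rightarrow>\<^sub>E {..<n}. f I)
      = (\<Sum>I \<in> (\<lambda>(y, I). I(m := y)) ` ({..<n} \<times> ({..<m} \<rightarrow>\<^sub>E {..<n})). f I)"
    by (simp add: lessThan_Suc PiE_insert_eq)
  also have "\<dots> = (\<Sum>(r, I) \<in> {..<n} \<times> ({..<m} \<rightarrow>\<^sub>E {..<n}). f (I(m := r)))"
    by (subst sum.reindex[OF inj_combinator[of m "{..<m}" "\<lambda>_. {..<n}", simplified]])
      (auto intro!: sum.cong)
  also have "\<dots> = (\<Sum>I \<in> {..<m} \<rightarrow>\<^sub>E {..<n}. \<Sum>r<n. f (I(m := r)))"
    by (subst sum.cartesian_product[symmetric]) (rule sum.swap)
  finally show ?thesis .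
qed

text \<open>Equivariance under diagonal matrices makes \<open>f\<close> linear in each column, so it
  expands over all choices \<open>I\<close> of basis vectors; averaging over column permutations
  turns the monomials into minors. Since \<open>I\<close> runs over all maps and not just increasing
  ones, \<open>fact g\<close> has to be divided out.\<close>

lemma alternating_expansion:
  fixes f :: "complex mat \<Rightarrow> complex"
  assumes q: "q \<in> pol ({..<n} \<times> {..<g})"
    and f: "\<And>U. U \<in> carrier_mat n g \<Longrightarrow> f U = q (\<lambda>si. U $$ si)"
    and equi: "\<And>U A. U \<in> carrier_mat n g \<Longrightarrow> A \<in> carrier_mat g g \<Longrightarrow> f (U * A) = det A * f U"
    and U: "U \<in> carrier_mat n g"
  shows "f U = (\<Sum>I \<in> {..<g} \<rightarrow>\<^sub>E {..<n}.
    f (transpose_mat (row_select n g I)) * det (row_select n g I * U)) / fact g"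
proof -
  have column: "f U = (\<Sum>r<n. U $$ (r, j) * f (unit_col r j U))"
    if U: "U \<in> carrier_mat n g" and j: "j < g" for U j
  proof -
    define W where "W = (\<lambda>x. mat n g (\<lambda>(s, i). if i = j then x s else U $$ (s, i)))"
    define \<phi> where "\<phi> = (\<lambda>x. q (\<lambda>(s, i). if i = j then x s else U $$ (s, i)))"
    have W: "W x \<in> carrier_mat n g" for x by (simp add: W_def)
    have f_W: "f (W x) = \<phi> x" for x
      unfolding f[OF W] \<phi>_def by (rule pol_cong[OF q]) (auto simp: W_def)
    have \<phi>: "\<phi> \<in> pol {..<n}"
      unfolding \<phi>_def by (rule pol_subst[OF q]) (auto intro!: pol_if pol.var pol.const)
    \<comment> \<open>Scaling column \<open>j\<close> by \<open>t\<close> is right multiplication by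
      a diagonal matrix of determinant \<open>t\<close>.\<close>
    have "\<phi> (\<lambda>v. t * x v) = t * \<phi> x" for t x
    proof -
      have "W (\<lambda>v. t * x v) = W x * multrow_mat g j t"
      proof (rule eq_matI)
        fix s i assume "s < dim_row (W x * multrow_mat g j t)" "i < dim_col (W x * multrow_mat g j t)"
        then have si: "s < n" "i < g" by (auto simp: W_def)
        have "multrow_mat g j t $$ (r, i) = (if r = i then if i = j then t else 1 else 0)" if "r < g" for r
          using that si by auto
        then have "(W x * multrow_mat g j t) $$ (s, i)
            = (\<Sum>r<g. W x $$ (s, r) * (if r = i then if i = j then t else 1 else 0))"
          using si by (subst mult_index_sum[OF W multrow_mat_carrier]) (simp_all cong: sum.cong_simp)
        also have "\<dots> = W x $$ (s, i) * (if i = j then t else 1)"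
          using si by (simp add: if_distrib[of "(*) _"] cong: if_cong)
        finally show "W (\<lambda>v. t * x v) $$ (s, i) = (W x * multrow_mat g j t) $$ (s, i)"
          using si by (simp add: W_def)
      qed (auto simp: W_def)
      then show ?thesis
        using equi[OF W multrow_mat_carrier, of x j t] j by (simp add: det_multrow_mat flip: f_W)
    qed
    note pol_homogeneous_linear[OF \<phi> finite_lessThan this]
    from this[of "\<lambda>s. U $$ (s, j)"]
    have "f (W (\<lambda>s. U $$ (s, j))) = (\<Sum>r<n. U $$ (r, j) * f (W (\<lambda>w. if w = r then 1 else 0)))"
      by (simp only: f_W)
    moreover have "W (\<lambda>s. U $$ (s, j)) = U"
      using U by (intro eq_matI) (auto simp: W_def)
    moreover have "W (\<lambda>w. if w = r then 1 else 0) = unit_col r j U" for r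
      using U by (intro eq_matI) (auto simp: W_def unit_col_def)
    ultimately show ?thesis by simp
  qed
  \<comment> \<open>The first \<open>m\<close> columns are already replaced by basis vectors;
    \<open>m\<close> counts the columns expanded so far.\<close>
  define units where "units = (\<lambda>m I U. mat n g (\<lambda>(s, i).
    if i < m then (if s = I i then 1 else 0) else (U :: complex mat) $$ (s, i)))"
  have expand: "f U = (\<Sum>I \<in> {..<m} \<rightarrow>\<^sub>E {..<n}. (\<Prod>i<m. U $$ (I i, i)) * f (units m I U))"
    if U: "U \<in> carrier_mat n g" and "m \<le> g" for U m
    using \<open>m \<le> g\<close>
  proof (induction m)
    case 0
    have "units 0 I U = U" for I using U by (intro eq_matI) (auto simp: units_def)
    then show ?case by simp
  next
    case (Suc m)
    have "f (units m I U) = (\<Sum>r<n. U $$ (r, m) * f (units (Suc m) (I(m := r)) U))" for I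
    proof -
      have "unit_col r m (units m I U) = units (Suc m) (I(m := r)) U" for r
        by (intro eq_matI) (auto simp: units_def unit_col_def)
      then show ?thesis
        using column[of "units m I U" m] Suc.prems by (simp add: units_def)
    qed
    with Suc show ?case
      by (simp add: sum_PiE_lessThan_Suc sum_distrib_left mult.assoc)
  qed
  have units_g: "units g I U = transpose_mat (row_select n g I)" for I U
    by (intro eq_matI) (auto simp: units_def row_select_def)
  define c where "c = (\<lambda>I. f (transpose_mat (row_select n g I)))"
  have perm: "of_int (sign p) * f U = (\<Sum>I \<in> {..<g} \<rightarrow>\<^sub>E {..<n}. (\<Prod>i<g. U $$ (I i, p i)) * c I)"
    if p: "p permutes {0..<g}" for p
  proof -
    \<comment> \<open>Right multiplication by the transpose of this permutation matrix moves column
      \<open>p i\<close> of \<open>U\<close> to position \<open>i\<close>.\<close>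
    define A :: "complex mat" where "A = mat g g (\<lambda>(i, j). 1\<^sub>m g $$ (p i, j))"
    have A: "A\<^sup>T \<in> carrier_mat g g" by (simp add: A_def)
    have "det A = of_int (sign p)"
      unfolding A_def by (subst det_permute_rows[OF _ p]) auto
    then have detA: "det (A\<^sup>T) = of_int (sign p)" by (subst det_transpose) (auto simp: A_def)
    have p_less: "p i < g" if "i < g" for i
      using p that permutes_in_image[of p "{0..<g}" i] by simp
    have UA: "(U * A\<^sup>T) $$ (s, i) = U $$ (s, p i)" if "s < n" "i < g" for s i
    proof -
      show ?thesis
        using that p_less
        by (subst mult_index_sum[OF U A]) (simp_all add: A_def if_distrib[of "(*) _"] cong: if_cong)
    qed
    have "of_int (sign p) * f U = f (U * A\<^sup>T)"
      using equi[OF U A] detA by simp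
    also have "\<dots> = (\<Sum>I \<in> {..<g} \<rightarrow>\<^sub>E {..<n}. (\<Prod>i<g. (U * A\<^sup>T) $$ (I i, i)) * c I)"
      using expand[of "U * A\<^sup>T" g] U A by (simp add: units_g c_def)
    also have "\<dots> = (\<Sum>I \<in> {..<g} \<rightarrow>\<^sub>E {..<n}. (\<Prod>i<g. U $$ (I i, p i)) * c I)"
      by (intro sum.cong refl arg_cong2[of _ _ _ _ "(*)"] prod.cong UA) auto
    finally show ?thesis .
  qed
  let ?\<P> = "{p. p permutes {0..<g}}"
  have det_select: "det (row_select n g I * U) = (\<Sum>p\<in>?\<P>. of_int (sign p) * (\<Prod>i<g. U $$ (I i, p i)))"
    if I: "I \<in> {..<g} \<rightarrow>\<^sub>E {..<n}" for I
  proof -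
    have "(row_select n g I * U) $$ (i, j) = U $$ (I i, j)" if "i < g" "j < g" for i j
    proof -
      have X: "row_select n g I \<in> carrier_mat g n" by (simp add: row_select_def)
      show ?thesis
        using that I by (subst mult_index_sum[OF X U])
          (auto simp: row_select_def if_distrib[of "\<lambda>a. a * _"] cong: if_cong)
    qed
    moreover have "p i < g" if "p permutes {0..<g}" "i < g" for p i
      using that permutes_in_image[of p "{0..<g}" i] by simp
    ultimately show ?thesis
      using U by (subst det_def'[of _ g])
        (auto simp: row_select_def atLeast0LessThan intro!: sum.cong prod.cong)
  qed
  \<comment> \<open>Each of the \<open>g!\<close> permutations contributes the square of its sign
    times \<open>f U\<close>; one of the two signs stays outside to form the determinant.\<close>
  have "fact g * f U = (\<Sum>p\<in>?\<P>. of_int (sign p) * (of_int (sign p) * f U))"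
    by (simp add: mult.assoc[symmetric] of_int_mult[symmetric] del: of_int_mult)
      (simp add: card_permutations[of "{0..<g}"])
  also have "\<dots> = (\<Sum>p\<in>?\<P>. of_int (sign p) *
      (\<Sum>I \<in> {..<g} \<rightarrow>\<^sub>E {..<n}. (\<Prod>i<g. U $$ (I i, p i)) * c I))"
    by (intro sum.cong refl arg_cong2[of _ _ _ _ "(*)"] perm) auto
  also have "\<dots> = (\<Sum>I \<in> {..<g} \<rightarrow>\<^sub>E {..<n}. c I *
      (\<Sum>p\<in>?\<P>. of_int (sign p) * (\<Prod>i<g. U $$ (I i, p i))))"
    by (simp add: sum_distrib_left sum.swap[of _ ?\<P>] algebra_simps)
  also have "\<dots> = (\<Sum>I \<in> {..<g} \<rightarrow>\<^sub>E {..<n}. c I * det (row_select n g I * U))"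
    by (intro sum.cong refl) (simp add: det_select)
  finally show ?thesis by (simp add: c_def field_simps)
qed

section \<open>Generators of the spaces of equivariant functions\<close>

text \<open>With the rows of \<open>X\<close> read as linear forms, \<open>det (X * U)\<close> is
  their wedge product evaluated on the columns of \<open>U\<close>. \<open>gen\<close> is thus a
  decomposable form times the conjugate of another.\<close>

definition gen :: "nat \<Rightarrow> nat \<Rightarrow> complex mat \<Rightarrow> complex mat \<Rightarrow> complex mat \<Rightarrow> complex" where
  "gen n g X Y = on_mat n g (\<lambda>U. det (X * U) * cnj (det (Y * U)))"

lemma on_mat_apply [simp]: "U \<in> carrier_mat n g \<Longrightarrow> on_mat n g f U = f U"
  by (simp add: on_mat_def)

lemma on_mat_off [simp]: "U \<notin> carrier_mat n g \<Longrightarrow> on_mat n g f U = 0"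
  by (simp add: on_mat_def)

lemma on_mat_eqI: "(\<And>U. U \<in> carrier_mat n g \<Longrightarrow> f U = h U) \<Longrightarrow> on_mat n g f = on_mat n g h"
  by (auto simp: on_mat_def)

lemma poly_funs_sum:
  assumes "\<And>i. i \<in> I \<Longrightarrow> (\<lambda>U. f i U) \<in> poly_funs n g"
  shows "(\<lambda>U. \<Sum>i\<in>I. f i U) \<in> poly_funs n g"
  using assms
  by (induction I rule: infinite_finite_induct) (auto intro: poly_funs.const poly_funs.add)

lemma poly_funs_prod:
  assumes "\<And>i. i \<in> I \<Longrightarrow> (\<lambda>U. f i U) \<in> poly_funs n g"
  shows "(\<lambda>U. \<Prod>i\<in>I. f i U) \<in> poly_funs n g"
  using assms
  by (induction I rule: infinite_finite_induct) (auto intro: poly_funs.const poly_funs.mult)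

lemma poly_funs_cnj:
  assumes "p \<in> poly_funs n g"
  shows "(\<lambda>U. cnj (p U)) \<in> poly_funs n g"
  using assms by induction (auto intro: poly_funs.intros)

lemma det_mult_poly_fun:
  assumes X: "X \<in> carrier_mat g n"
  shows "\<exists>p \<in> poly_funs n g. \<forall>U \<in> carrier_mat n g. det (X * U) = p U"
proof (intro bexI ballI)
  let ?p = "\<lambda>U. \<Sum>\<sigma> | \<sigma> permutes {0..<g}. of_int (sign \<sigma>) *
    (\<Prod>i = 0..<g. \<Sum>s<n. X $$ (i, s) * U $$ (s, \<sigma> i))"
  have less: "\<sigma> i < g" if "\<sigma> permutes {0..<g}" "i < g" for \<sigma> i
    using that permutes_in_image[of \<sigma> "{0..<g}" i] by simp
  then show "?p \<in> poly_funs n g"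
    by (auto intro!: poly_funs_sum poly_funs_prod poly_funs.mult poly_funs.const poly_funs.entry)
  fix U :: "complex mat" assume U: "U \<in> carrier_mat n g"
  then show "det (X * U) = ?p U"
    using X less by (subst det_def'[of _ g])
      (auto intro!: sum.cong prod.cong simp del: index_mult_mat simp: mult_index_sum[OF X U])
qed

lemma \<F>_off: "P \<in> \<F> n g \<Longrightarrow> U \<notin> carrier_mat n g \<Longrightarrow> P U = 0"
  by (auto simp: \<F>_def)

lemma \<F>_poly: "P \<in> \<F> n g \<Longrightarrow> \<exists>p \<in> poly_funs n g. P = on_mat n g p"
  by (simp add: \<F>_def)

lemma of_real_cmod_square: "of_real ((cmod z)\<^sup>2) = z * cnj z"
  by (simp only: complex_norm_square)

lemma \<F>_equivariant:
  "P \<in> \<F> n g \<Longrightarrow> U \<in> carrier_mat n g \<Longrightarrow> A \<in> carrier_mat g g \<Longrightarrow>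
    P (U * A) = det A * cnj (det A) * P U"
  unfolding \<F>_def of_real_cmod_square by blast

lemma \<F>_I:
  assumes "p \<in> poly_funs n g" "P = on_mat n g p"
    and "\<And>U A. U \<in> carrier_mat n g \<Longrightarrow> A \<in> carrier_mat g g \<Longrightarrow>
      P (U * A) = det A * cnj (det A) * P U"
  shows "P \<in> \<F> n g"
  unfolding \<F>_def of_real_cmod_square using assms by blast

lemma \<F>_comb:
  assumes "P \<in> \<F> n g" "P' \<in> \<F> n g"
  shows "(\<lambda>U. a * P U + b * P' U) \<in> \<F> n g"
proof -
  obtain p p' where p: "p \<in> poly_funs n g" "P = on_mat n g p" "p' \<in> poly_funs n g" "P' = on_mat n g p'"
    using assms \<F>_poly by meson
  show ?thesis
  proof (rule \<F>_I)
    show "(\<lambda>U. a * p U + b * p' U) \<in> poly_funs n g"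
      by (intro poly_funs.add poly_funs.mult poly_funs.const p)
    show "(\<lambda>U. a * P U + b * P' U) = on_mat n g (\<lambda>U. a * p U + b * p' U)"
      by (auto simp: p on_mat_def)
  qed (use assms in \<open>simp add: \<F>_equivariant algebra_simps\<close>)
qed

lemma gen_in_\<F>:
  assumes X: "X \<in> carrier_mat g n" and Y: "Y \<in> carrier_mat g n"
  shows "gen n g X Y \<in> \<F> n g"
proof -
  obtain p q where p: "p \<in> poly_funs n g" "\<And>U. U \<in> carrier_mat n g \<Longrightarrow> det (X * U) = p U"
    and q: "q \<in> poly_funs n g" "\<And>U. U \<in> carrier_mat n g \<Longrightarrow> det (Y * U) = q U"
    using det_mult_poly_fun[OF X] det_mult_poly_fun[OF Y] by metis
  show ?thesis
  proof (rule \<F>_I)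
    show "(\<lambda>U. p U * cnj (q U)) \<in> poly_funs n g"
      by (intro poly_funs.mult poly_funs_cnj p q)
    show "gen n g X Y = on_mat n g (\<lambda>U. p U * cnj (q U))"
      unfolding gen_def by (rule on_mat_eqI) (simp add: p q)
    fix U A :: "complex mat"
    assume U: "U \<in> carrier_mat n g" and A: "A \<in> carrier_mat g g"
    have "det (Z * (U * A)) = det (Z * U) * det A" if Z: "Z \<in> carrier_mat g n" for Z
      unfolding assoc_mult_mat[OF Z U A, symmetric] by (rule det_mult) (use Z U A in auto)
    then show "gen n g X Y (U * A) = det A * cnj (det A) * gen n g X Y U"
      using U A X Y by (simp add: gen_def)
  qed
qed

text \<open>The polarisation of \<open>P\<close> is alternating in each of its two matrix arguments,
  so \<open>alternating_expansion\<close> is applied first to one and then to the other.\<close>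

lemma \<F>_sum_gen:
  assumes P: "P \<in> \<F> n g"
  obtains c where "\<And>U. U \<in> carrier_mat n g \<Longrightarrow> P U =
    (\<Sum>I \<in> {..<g} \<rightarrow>\<^sub>E {..<n}. \<Sum>J \<in> {..<g} \<rightarrow>\<^sub>E {..<n}.
      c I J * gen n g (row_select n g I) (row_select n g J) U)"
proof -
  obtain p where p: "p \<in> poly_funs n g" "P = on_mat n g p" using \<F>_poly[OF P] by blast
  obtain q where q: "q \<in> pol (UNIV \<times> {..<n} \<times> {..<g})"
    and pq: "\<And>U. p U = q (\<lambda>(b, si). if b then cnj (U $$ si) else U $$ si)"
    using poly_funs_polarise[OF p(1)] by auto
  have P_q: "P U = q (mat_pair U (map_mat cnj U))" if "U \<in> carrier_mat n g" for U
  proof -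
    have "P U = q (\<lambda>(b, si). if b then cnj (U $$ si) else U $$ si)"
      using that by (simp add: p pq)
    also have "\<dots> = q (mat_pair U (map_mat cnj U))"
      by (rule pol_cong[OF q]) (use that in \<open>auto simp: mat_pair_def\<close>)
    finally show ?thesis .
  qed
  have equi: "q (mat_pair (U * A) (V * B)) = det A * det B * q (mat_pair U V)"
    if "U \<in> carrier_mat n g" "V \<in> carrier_mat n g" "A \<in> carrier_mat g g" "B \<in> carrier_mat g g" for U V A B
    using that \<F>_equivariant[OF P]
    by (intro polarised_equivariance[OF q]) (simp_all flip: P_q)
  define E where "E = (\<lambda>I. transpose_mat (row_select n g I))"
  have E: "E I \<in> carrier_mat n g" for I by (simp add: E_def row_select_def)
  \<comment> \<open>Taking \<open>B\<close> to be the identity in \<open>equi\<close> isolates the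
    first argument; \<open>right\<close> takes \<open>A\<close> to be the identity.\<close>
  have left: "q (mat_pair U V) = (\<Sum>I \<in> {..<g} \<rightarrow>\<^sub>E {..<n}.
      q (mat_pair (E I) V) * det (row_select n g I * U)) / fact g"
    if U: "U \<in> carrier_mat n g" and V: "V \<in> carrier_mat n g" for U V
    unfolding E_def
  proof (rule alternating_expansion[OF _ _ _ U])
    show "(\<lambda>x. q (\<lambda>(b, si). if b then V $$ si else x si)) \<in> pol ({..<n} \<times> {..<g})"
      by (rule pol_subst[OF q]) (auto intro!: pol_if pol.var pol.const)
    show "q (mat_pair (U * A) V) = det A * q (mat_pair U V)"
      if "U \<in> carrier_mat n g" "A \<in> carrier_mat g g" for U A
      using equi[OF that(1) V that(2) one_carrier_mat] V by simp
  qed (simp add: mat_pair_def)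
  have right: "q (mat_pair U V) = (\<Sum>J \<in> {..<g} \<rightarrow>\<^sub>E {..<n}.
      q (mat_pair U (E J)) * det (row_select n g J * V)) / fact g"
    if U: "U \<in> carrier_mat n g" and V: "V \<in> carrier_mat n g" for U V
    unfolding E_def
  proof (rule alternating_expansion[OF _ _ _ V])
    show "(\<lambda>x. q (\<lambda>(b, si). if b then x si else U $$ si)) \<in> pol ({..<n} \<times> {..<g})"
      by (rule pol_subst[OF q]) (auto intro!: pol_if pol.var pol.const)
    show "q (mat_pair U (V * B)) = det B * q (mat_pair U V)"
      if "V \<in> carrier_mat n g" "B \<in> carrier_mat g g" for V B
      using equi[OF U that(1) one_carrier_mat that(2)] U by simp
  qed (simp add: mat_pair_def)
  have cnj: "det (row_select n g J * map_mat cnj U) = cnj (det (row_select n g J * U))"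
    if U: "U \<in> carrier_mat n g" for J U
  proof -
    have X: "row_select n g J \<in> carrier_mat g n" by (simp add: row_select_def)
    have "map_mat cnj (row_select n g J) = row_select n g J"
      by (intro eq_matI) (auto simp: row_select_def)
    then show ?thesis
      using map_mat_cnj_mult[OF X U] det_map_mat_cnj by metis
  qed
  show ?thesis
  proof (rule that)
    fix U :: "complex mat" assume U: "U \<in> carrier_mat n g"
    then have "P U = (\<Sum>I \<in> {..<g} \<rightarrow>\<^sub>E {..<n}.
      (\<Sum>J \<in> {..<g} \<rightarrow>\<^sub>E {..<n}. q (mat_pair (E I) (E J)) * cnj (det (row_select n g J * U))) / fact g
        * det (row_select n g I * U)) / fact g"
      by (simp add: P_q left right[OF E] cnj)
    also have "\<dots> = (\<Sum>I \<in> {..<g} \<rightarrow>\<^sub>E {..<n}. \<Sum>J \<in> {..<g} \<rightarrow>\<^sub>E {..<n}.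
      q (mat_pair (E I) (E J)) / (fact g * fact g)
        * gen n g (row_select n g I) (row_select n g J) U)"
      using U by (simp add: gen_def sum_divide_distrib sum_distrib_left sum_distrib_right mult_ac)
    finally show "P U = \<dots>" .
  qed
qed

text \<open>The generators span, so an identity linear in \<open>P\<close> has to be checked on them
  only. Membership is available in the combination case because linearity of the derivatives depends
  on differentiability.\<close>

lemma \<F>_induct [consumes 1, case_names gen comb]:
  assumes P: "P \<in> \<F> n g"
    and gen: "\<And>X Y. X \<in> carrier_mat g n \<Longrightarrow> Y \<in> carrier_mat g n \<Longrightarrow> Q (gen n g X Y)"
    and comb: "\<And>P P' a b. P \<in> \<F> n g \<Longrightarrow> P' \<in> \<F> n g \<Longrightarrow> Q P \<Longrightarrow> Q P' \<Longrightarrow> Q (\<lambda>U. a * P U + b * P' U)"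
  shows "Q P"
proof -
  \<comment> \<open>Membership is carried along so that \<open>comb\<close> applies to partial
    sums.\<close>
  let ?Q = "\<lambda>P. P \<in> \<F> n g \<and> Q P"
  have Q_comb: "?Q (\<lambda>U. a * P U + b * P' U)" if "?Q P" "?Q P'" for P P' a b
    using that comb \<F>_comb by blast
  have Q_gen: "?Q (gen n g X Y)" if "X \<in> carrier_mat g n" "Y \<in> carrier_mat g n" for X Y
    using that gen gen_in_\<F> by blast
  have "?Q (\<lambda>U. 0)"
    using Q_comb[OF Q_gen Q_gen, of "0\<^sub>m g n" "0\<^sub>m g n" "0\<^sub>m g n" "0\<^sub>m g n" 0 0] by simp
  then have Q_sum: "?Q (\<lambda>U. \<Sum>i\<in>I. c i * f i U)" if "\<And>i. i \<in> I \<Longrightarrow> ?Q (f i)"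
    for I :: "(nat \<Rightarrow> nat) set" and c f
    using that
  proof (induction I rule: infinite_finite_induct)
    case (insert i I)
    then show ?case using Q_comb[of "f i" "\<lambda>U. \<Sum>i\<in>I. c i * f i U" "c i" 1] by simp
  qed auto
  obtain c where c: "\<And>U. U \<in> carrier_mat n g \<Longrightarrow> P U =
    (\<Sum>I \<in> {..<g} \<rightarrow>\<^sub>E {..<n}. \<Sum>J \<in> {..<g} \<rightarrow>\<^sub>E {..<n}.
      c I J * gen n g (row_select n g I) (row_select n g J) U)"
    using \<F>_sum_gen[OF P] by blast
  have "P = (\<lambda>U. \<Sum>I \<in> {..<g} \<rightarrow>\<^sub>E {..<n}. 1 * (\<Sum>J \<in> {..<g} \<rightarrow>\<^sub>E {..<n}.
      c I J * gen n g (row_select n g I) (row_select n g J) U))"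
  proof
    fix U
    show "P U = (\<Sum>I \<in> {..<g} \<rightarrow>\<^sub>E {..<n}. 1 * (\<Sum>J \<in> {..<g} \<rightarrow>\<^sub>E {..<n}.
      c I J * gen n g (row_select n g I) (row_select n g J) U))"
      using c \<F>_off[OF P] by (cases "U \<in> carrier_mat n g") (simp_all add: gen_def)
  qed
  moreover have "?Q \<dots>"
    by (intro Q_sum Q_gen) (auto simp: row_select_def)
  ultimately show ?thesis by simp
qed

section \<open>Wirtinger calculus\<close>

text \<open>A relational form is used because \<open>vector_derivative\<close> is meaningful only
  where a derivative exists. With \<open>\<alpha>\<close> and \<open>\<beta>\<close> the two
  Wirtinger derivatives, the real direction gives \<open>\<alpha> + \<beta>\<close> and the
  imaginary one \<open>\<i> * (\<alpha> - \<beta>)\<close>.\<close>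

definition has_wirt ::
    "(complex mat \<Rightarrow> complex) \<Rightarrow> nat \<Rightarrow> nat \<Rightarrow> complex mat \<Rightarrow> complex \<Rightarrow> complex \<Rightarrow> bool" where
  "has_wirt f s i U \<alpha> \<beta> \<longleftrightarrow>
     ((\<lambda>t. f (shift_entry s i (of_real t) U)) has_vector_derivative (\<alpha> + \<beta>)) (at 0) \<and>
     ((\<lambda>t. f (shift_entry s i (\<i> * of_real t) U)) has_vector_derivative (\<i> * (\<alpha> - \<beta>))) (at 0)"

lemma has_wirt_imp_wirt: "has_wirt f s i U \<alpha> \<beta> \<Longrightarrow> wirt s i f U = \<alpha>"
  by (auto simp: has_wirt_def wirt_def partial_re_def partial_im_def dest!: vector_derivative_at
      simp flip: mult.assoc)

lemma has_wirt_imp_wirt_bar: "has_wirt f s i U \<alpha> \<beta> \<Longrightarrow> wirt_bar s i f U = \<beta>"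
  by (auto simp: has_wirt_def wirt_bar_def partial_re_def partial_im_def dest!: vector_derivative_at
      simp flip: mult.assoc)

lemma shift_entry_carrier [simp]: "shift_entry s i w U \<in> carrier_mat n g \<longleftrightarrow> U \<in> carrier_mat n g"
  unfolding carrier_mat_def by (simp add: shift_entry_def)

lemma shift_entry_0 [simp]: "shift_entry s i 0 U = U"
  by (intro eq_matI) (auto simp: shift_entry_def)

lemma shift_entry_index:
  "U \<in> carrier_mat n g \<Longrightarrow> r < n \<Longrightarrow> c < g \<Longrightarrow>
    shift_entry s i w U $$ (r, c) = U $$ (r, c) + (if r = s \<and> c = i then w else 0)"
  by (auto simp: shift_entry_def)

lemma has_wirt_const: "has_wirt (\<lambda>U. c) s i U 0 0"
  by (simp add: has_wirt_def)

lemma has_wirt_affine: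
  assumes "\<And>w. f (shift_entry s i w U) = f U + w * a"
  shows "has_wirt f s i U a 0"
proof -
  have "((\<lambda>t. f U + c * of_real t * a) has_vector_derivative c * a) (at 0)" for c
  proof -
    have "((\<lambda>t. t *\<^sub>R (c * a)) has_vector_derivative c * a) (at 0)"
      using has_vector_derivative_scaleR[OF DERIV_ident has_vector_derivative_const, of "c * a" 0]
      by simp
    from has_vector_derivative_add[OF has_vector_derivative_const this, of "f U"]
    show ?thesis by (simp add: scaleR_conv_of_real mult_ac)
  qed
  from this[of 1] this[of \<i>] show ?thesis
    by (simp add: has_wirt_def assms)
qed

lemma has_wirt_cnj:
  assumes "has_wirt f s i U \<alpha> \<beta>"
  shows "has_wirt (\<lambda>U. cnj (f U)) s i U (cnj \<beta>) (cnj \<alpha>)"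
proof -
  note d = assms[unfolded has_wirt_def]
  show ?thesis
    unfolding has_wirt_def
    using has_vector_derivative_cnj[OF d[THEN conjunct1]] has_vector_derivative_cnj[OF d[THEN conjunct2]]
    by (simp add: algebra_simps)
qed

lemma has_wirt_add:
  assumes "has_wirt f s i U \<alpha> \<beta>" "has_wirt h s i U \<gamma> \<delta>"
  shows "has_wirt (\<lambda>U. f U + h U) s i U (\<alpha> + \<gamma>) (\<beta> + \<delta>)"
proof -
  note d = assms[unfolded has_wirt_def]
  show ?thesis
    unfolding has_wirt_def
    using has_vector_derivative_add[OF d(1)[THEN conjunct1] d(2)[THEN conjunct1]]
      has_vector_derivative_add[OF d(1)[THEN conjunct2] d(2)[THEN conjunct2]]
    by (simp add: algebra_simps)
qed

lemma has_wirt_mult: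
  assumes "has_wirt f s i U \<alpha> \<beta>" "has_wirt h s i U \<gamma> \<delta>"
  shows "has_wirt (\<lambda>U. f U * h U) s i U (\<alpha> * h U + f U * \<gamma>) (\<beta> * h U + f U * \<delta>)"
proof -
  note d = assms[unfolded has_wirt_def]
  show ?thesis
    unfolding has_wirt_def
    using has_vector_derivative_mult[OF d(1)[THEN conjunct1] d(2)[THEN conjunct1]]
      has_vector_derivative_mult[OF d(1)[THEN conjunct2] d(2)[THEN conjunct2]]
    by (simp add: algebra_simps)
qed

lemma has_wirt_comb:
  assumes "has_wirt f s i U \<alpha> \<beta>" "has_wirt h s i U \<gamma> \<delta>"
  shows "has_wirt (\<lambda>U. a * f U + b * h U) s i U (a * \<alpha> + b * \<gamma>) (a * \<beta> + b * \<delta>)"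
  using has_wirt_add[OF has_wirt_mult[OF has_wirt_const assms(1), of a]
      has_wirt_mult[OF has_wirt_const assms(2), of b]] by simp

lemma has_wirt_cong:
  assumes "\<And>V. V \<in> carrier_mat n g \<Longrightarrow> f V = h V" "U \<in> carrier_mat n g"
  shows "has_wirt f s i U \<alpha> \<beta> \<longleftrightarrow> has_wirt h s i U \<alpha> \<beta>"
  using assms by (simp add: has_wirt_def)

lemma wirt_cong:
  assumes "\<And>V. V \<in> carrier_mat n g \<Longrightarrow> f V = h V" "U \<in> carrier_mat n g"
  shows "wirt s i f U = wirt s i h U"
  using assms by (simp add: wirt_def partial_re_def partial_im_def)

text \<open>That the derivatives are polynomial functions again is what gives the second derivatives
  in \<open>last_laplacian\<close>.\<close>

lemma poly_funs_has_wirt: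
  assumes "p \<in> poly_funs n g"
  shows "\<exists>p\<^sub>1 \<in> poly_funs n g. \<exists>p\<^sub>2 \<in> poly_funs n g.
    \<forall>U \<in> carrier_mat n g. has_wirt p s i U (p\<^sub>1 U) (p\<^sub>2 U)"
  using assms
proof induction
  case (const c)
  show ?case
    by (intro bexI[OF _ poly_funs.const[of 0]] ballI has_wirt_const)
next
  case (entry r c)
  then show ?case
    by (intro bexI[OF _ poly_funs.const[of "if r = s \<and> c = i then 1 else 0"]]
        bexI[OF _ poly_funs.const[of 0]] ballI has_wirt_affine) (simp add: shift_entry_index)
next
  case (cnj_entry r c)
  have "has_wirt (\<lambda>U. U $$ (r, c)) s i U (if r = s \<and> c = i then 1 else 0) 0"
    if "U \<in> carrier_mat n g" for U
    using cnj_entry that by (intro has_wirt_affine) (simp add: shift_entry_index)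
  from has_wirt_cnj[OF this] show ?case
    by (intro bexI[OF _ poly_funs.const[of "if r = s \<and> c = i then 1 else 0"]]
        bexI[OF _ poly_funs.const[of 0]] ballI) (simp add: if_distrib cong: if_cong)
next
  case (add p q)
  then obtain p\<^sub>1 p\<^sub>2 q\<^sub>1 q\<^sub>2 where "p\<^sub>1 \<in> poly_funs n g" "p\<^sub>2 \<in> poly_funs n g"
    "q\<^sub>1 \<in> poly_funs n g" "q\<^sub>2 \<in> poly_funs n g"
    "\<forall>U \<in> carrier_mat n g. has_wirt p s i U (p\<^sub>1 U) (p\<^sub>2 U)"
    "\<forall>U \<in> carrier_mat n g. has_wirt q s i U (q\<^sub>1 U) (q\<^sub>2 U)" by blast
  then show ?case
    by (intro bexI[of _ "\<lambda>U. p\<^sub>1 U + q\<^sub>1 U"] bexI[of _ "\<lambda>U. p\<^sub>2 U + q\<^sub>2 U"] ballI has_wirt_add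
        poly_funs.add) auto
next
  case (mult p q)
  then obtain p\<^sub>1 p\<^sub>2 q\<^sub>1 q\<^sub>2 where "p\<^sub>1 \<in> poly_funs n g" "p\<^sub>2 \<in> poly_funs n g"
    "q\<^sub>1 \<in> poly_funs n g" "q\<^sub>2 \<in> poly_funs n g"
    "\<forall>U \<in> carrier_mat n g. has_wirt p s i U (p\<^sub>1 U) (p\<^sub>2 U)"
    "\<forall>U \<in> carrier_mat n g. has_wirt q s i U (q\<^sub>1 U) (q\<^sub>2 U)" by blast
  then show ?case
    using mult.hyps
    by (intro bexI[of _ "\<lambda>U. p\<^sub>1 U * q U + p U * q\<^sub>1 U"] bexI[of _ "\<lambda>U. p\<^sub>2 U * q U + p U * q\<^sub>2 U"]
        ballI has_wirt_mult poly_funs.add poly_funs.mult) auto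
qed

lemma \<F>_has_wirt:
  assumes "P \<in> \<F> n g"
  obtains p\<^sub>1 p\<^sub>2 where "p\<^sub>1 \<in> poly_funs n g" "p\<^sub>2 \<in> poly_funs n g"
    "\<And>U. U \<in> carrier_mat n g \<Longrightarrow> has_wirt P s i U (p\<^sub>1 U) (p\<^sub>2 U)"
proof -
  obtain p where p: "p \<in> poly_funs n g" "P = on_mat n g p" using \<F>_poly[OF assms] by blast
  have "has_wirt P s i U \<alpha> \<beta> \<longleftrightarrow> has_wirt p s i U \<alpha> \<beta>" if "U \<in> carrier_mat n g" for U \<alpha> \<beta>
    by (rule has_wirt_cong[OF _ that]) (simp add: p)
  then show ?thesis using poly_funs_has_wirt[OF p(1), of s i] that by metis
qed

section \<open>Linearity of the derivatives and of the three operators\<close>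

lemma wirt_comb:
  assumes "P \<in> \<F> n g" "P' \<in> \<F> n g" and U: "U \<in> carrier_mat n g"
  shows "wirt s i (\<lambda>U. a * P U + b * P' U) U = a * wirt s i P U + b * wirt s i P' U"
    and "wirt_bar s i (\<lambda>U. a * P U + b * P' U) U = a * wirt_bar s i P U + b * wirt_bar s i P' U"
proof -
  obtain \<alpha> \<beta> \<gamma> \<delta> where *: "has_wirt P s i U \<alpha> \<beta>" "has_wirt P' s i U \<gamma> \<delta>"
    using \<F>_has_wirt assms by metis
  note h = *[THEN has_wirt_imp_wirt] *[THEN has_wirt_imp_wirt_bar]
    has_wirt_comb[OF *, THEN has_wirt_imp_wirt] has_wirt_comb[OF *, THEN has_wirt_imp_wirt_bar]
  show "wirt s i (\<lambda>U. a * P U + b * P' U) U = a * wirt s i P U + b * wirt s i P' U"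
    "wirt_bar s i (\<lambda>U. a * P U + b * P' U) U = a * wirt_bar s i P U + b * wirt_bar s i P' U"
    by (simp_all add: h)
qed

text \<open>Linearity of the outer derivative requires the inner one to be differentiable, which
  holds since \<open>wirt_bar\<close> agrees on the carrier with a polynomial function.\<close>

lemma last_laplacian_comb:
  assumes P: "P \<in> \<F> n (Suc g)" "P' \<in> \<F> n (Suc g)" and U: "U \<in> carrier_mat n (Suc g)"
  shows "last_laplacian n g (\<lambda>U. a * P U + b * P' U) U
    = a * last_laplacian n g P U + b * last_laplacian n g P' U"
proof -
  have "wirt s g (wirt_bar s g (\<lambda>U. a * P U + b * P' U)) U
      = a * wirt s g (wirt_bar s g P) U + b * wirt s g (wirt_bar s g P') U" for s
  proof -
    have "\<exists>\<alpha> \<beta>. has_wirt (wirt_bar s g Q) s g U \<alpha> \<beta>" if Q: "Q \<in> \<F> n (Suc g)" for Q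
    proof -
      obtain q where q: "q \<in> poly_funs n (Suc g)"
        "\<And>U. U \<in> carrier_mat n (Suc g) \<Longrightarrow> wirt_bar s g Q U = q U"
        using \<F>_has_wirt[OF Q, of s g] has_wirt_imp_wirt_bar by metis
      obtain \<alpha> \<beta> where "has_wirt q s g U \<alpha> \<beta>"
        using poly_funs_has_wirt[OF q(1), of s g] U by blast
      then have "has_wirt (wirt_bar s g Q) s g U \<alpha> \<beta>"
        by (subst has_wirt_cong[OF q(2) U])
      then show ?thesis by blast
    qed
    then obtain \<alpha> \<beta> \<gamma> \<delta> where *: "has_wirt (wirt_bar s g P) s g U \<alpha> \<beta>"
      "has_wirt (wirt_bar s g P') s g U \<gamma> \<delta>"
      using P by meson
    have "wirt s g (wirt_bar s g (\<lambda>U. a * P U + b * P' U)) U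
        = wirt s g (\<lambda>U. a * wirt_bar s g P U + b * wirt_bar s g P' U) U"
      by (rule wirt_cong[OF _ U]) (rule wirt_comb[OF P])
    then show ?thesis
      using *[THEN has_wirt_imp_wirt] has_wirt_comb[OF *, THEN has_wirt_imp_wirt] by simp
  qed
  then show ?thesis
    by (simp add: last_laplacian_def sum.distrib sum_distrib_left)
qed

lemma append_zero_col_carrier [simp]: "V \<in> carrier_mat n g \<Longrightarrow> append_zero_col V \<in> carrier_mat n (Suc g)"
  by (auto simp: append_zero_col_def)

lemma delete_col_carrier [simp]: "U \<in> carrier_mat n (Suc g) \<Longrightarrow> delete_col i U \<in> carrier_mat n g"
  by (auto simp: delete_col_def)

lemma lower_comb:
  assumes "P \<in> \<F> n (Suc g)" "P' \<in> \<F> n (Suc g)"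
  shows "lower n g (\<lambda>U. a * P U + b * P' U) = (\<lambda>U. a * lower n g P U + b * lower n g P' U)"
  using assms by (auto simp: lower_def on_mat_def last_laplacian_comb)

text \<open>Shifting an entry of column \<open>j\<close> commutes with deleting column
  \<open>i\<close>, up to the renumbering of the columns to the right of \<open>i\<close>.\<close>

lemma wirt_delete_col:
  assumes U: "U \<in> carrier_mat n (Suc g)" and "i < Suc g" "j < Suc g" "i \<noteq> j"
  shows "wirt s j (\<lambda>W. f (delete_col i W)) U
    = wirt s (if j < i then j else j - 1) f (delete_col i U)"
proof -
  have "delete_col i (shift_entry s j w U)
      = shift_entry s (if j < i then j else j - 1) w (delete_col i U)" for w
    using assms by (intro eq_matI) (auto simp: delete_col_def shift_entry_def)
  then show ?thesis
    by (simp add: wirt_def partial_re_def partial_im_def)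
qed

lemma m_coeff_comb:
  assumes "P \<in> \<F> n g" "P' \<in> \<F> n g" "U \<in> carrier_mat n (Suc g)" "i < Suc g" "j < Suc g"
  shows "m_coeff n (\<lambda>U. a * P U + b * P' U) i j U = a * m_coeff n P i j U + b * m_coeff n P' i j U"
proof (cases "i = j")
  case False
  have "U $$ (s, i) * wirt s j (\<lambda>W. a * P (delete_col i W) + b * P' (delete_col i W)) U
      = a * (U $$ (s, i) * wirt s j (\<lambda>W. P (delete_col i W)) U)
        + b * (U $$ (s, i) * wirt s j (\<lambda>W. P' (delete_col i W)) U)" for s
    using assms False
      wirt_delete_col[of U n g i j s P] wirt_delete_col[of U n g i j s P']
      wirt_delete_col[of U n g i j s "\<lambda>U. a * P U + b * P' U"]
    by (simp add: wirt_comb[OF assms(1,2)] algebra_simps)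
  then show ?thesis
    using False by (simp add: m_coeff_def sum.distrib sum_distrib_left)
qed (simp add: m_coeff_def)

lemma raise_comb:
  assumes "P \<in> \<F> n g" "P' \<in> \<F> n g"
  shows "raise n g (\<lambda>U. a * P U + b * P' U) = (\<lambda>U. a * raise n g P U + b * raise n g P' U)"
proof
  fix U
  show "raise n g (\<lambda>U. a * P U + b * P' U) U = a * raise n g P U + b * raise n g P' U"
  proof (cases "U \<in> carrier_mat n (Suc g)")
    case True
    have "herm n U k l * m_coeff n (\<lambda>U. a * P U + b * P' U) l k U
        = a * (herm n U k l * m_coeff n P l k U) + b * (herm n U k l * m_coeff n P' l k U)"
      if "k < Suc g" "l < Suc g" for k l
      using that by (simp add: m_coeff_comb[OF assms True] algebra_simps)
    then have "(\<Sum>k<Suc g. \<Sum>l<Suc g. herm n U k l * m_coeff n (\<lambda>U. a * P U + b * P' U) l k U)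
      = (\<Sum>k<Suc g. \<Sum>l<Suc g. a * (herm n U k l * m_coeff n P l k U) + b * (herm n U k l * m_coeff n P' l k U))"
      by (intro sum.cong refl) auto
    then show ?thesis
      using True by (simp only: raise_def on_mat_apply sum.distrib sum_distrib_left)
  qed (simp add: raise_def)
qed

lemma weight_comb:
  assumes "P \<in> \<F> n g" "P' \<in> \<F> n g"
  shows "weight n g (\<lambda>U. a * P U + b * P' U) = (\<lambda>U. a * weight n g P U + b * weight n g P' U)"
proof
  fix U
  show "weight n g (\<lambda>U. a * P U + b * P' U) U = a * weight n g P U + b * weight n g P' U"
    by (cases "U \<in> carrier_mat n g")
      (simp_all add: weight_def wirt_comb[OF assms] distrib_left sum.distrib sum_distrib_left algebra_simps)
qed

section \<open>Raising operator and weight\<close>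

lemma unit_col_carrier [simp]: "unit_col s i U \<in> carrier_mat n g \<longleftrightarrow> U \<in> carrier_mat n g"
  unfolding carrier_mat_def by (simp add: unit_col_def)

lemma unit_col_shift [simp]: "unit_col s i (shift_entry r i w U) = unit_col s i U"
  by (intro eq_matI) (auto simp: unit_col_def shift_entry_def)

text \<open>Linearity in column \<open>i\<close>, by Laplace expansion along it: the cofactors do
  not see that column. The summand with \<open>unit_col s i U\<close> is therefore also the
  Wirtinger derivative in entry \<open>(s, i)\<close>, times that entry.\<close>

lemma det_mult_unit_col:
  assumes X: "X \<in> carrier_mat g n" and U: "U \<in> carrier_mat n g" and i: "i < g"
  shows "det (X * U) = (\<Sum>s<n. U $$ (s, i) * det (X * unit_col s i U))"
proof -
  have unit: "det (X * unit_col s i U) = (\<Sum>r<g. X $$ (r, s) * cofactor (X * U) r i)" if "s < n" for s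
  proof -
    have V: "unit_col s i U \<in> carrier_mat n g" using U by simp
    have "(X * unit_col s i U) $$ (r, i) = X $$ (r, s)" if "r < g" for r
      using that \<open>s < n\<close> i U
      by (subst mult_index_sum[OF X V])
        (auto simp: unit_col_def if_distrib[of "(*) _"] cong: if_cong)
    moreover have "mat_delete (X * unit_col s i U) r i = mat_delete (X * U) r i" for r
      unfolding mat_delete_def
      using X U V i by (intro eq_matI) (auto simp: unit_col_def scalar_prod_def intro!: sum.cong)
    then have "cofactor (X * unit_col s i U) r i = cofactor (X * U) r i" for r
      by (simp add: cofactor_def)
    ultimately show ?thesis
      by (subst laplace_expansion_column[of _ g, OF mult_carrier_mat[OF X V] i]) simp
  qed
  have "det (X * U) = (\<Sum>r<g. (X * U) $$ (r, i) * cofactor (X * U) r i)"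
    by (rule laplace_expansion_column[OF mult_carrier_mat[OF X U] i])
  also have "\<dots> = (\<Sum>r<g. \<Sum>s<n. U $$ (s, i) * (X $$ (r, s) * cofactor (X * U) r i))"
    by (intro sum.cong refl, subst mult_index_sum[OF X U])
      (auto simp: i sum_distrib_left mult_ac)
  also have "\<dots> = (\<Sum>s<n. U $$ (s, i) * det (X * unit_col s i U))"
    by (subst sum.swap) (simp add: unit sum_distrib_left)
  finally show ?thesis .
qed

lemma det_mult_shift_entry:
  assumes X: "X \<in> carrier_mat g n" and U: "U \<in> carrier_mat n g" and "s < n" "i < g"
  shows "det (X * shift_entry s i w U) = det (X * U) + w * det (X * unit_col s i U)"
proof -
  have "det (X * shift_entry s i w U)
      = (\<Sum>r<n. U $$ (r, i) * det (X * unit_col r i U) + (if r = s then w * det (X * unit_col r i U) else 0))"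
    using assms by (subst det_mult_unit_col[OF X, of _ i])
      (auto intro!: sum.cong simp: shift_entry_index[OF U] algebra_simps)
  also have "\<dots> = (\<Sum>r<n. U $$ (r, i) * det (X * unit_col r i U)) + w * det (X * unit_col s i U)"
    using \<open>s < n\<close> by (simp add: sum.distrib)
  finally show ?thesis by (simp add: det_mult_unit_col[OF X U \<open>i < g\<close>])
qed

lemma has_wirt_det:
  assumes "X \<in> carrier_mat g n" "U \<in> carrier_mat n g" "s < n" "i < g"
  shows "has_wirt (\<lambda>U. det (X * U)) s i U (det (X * unit_col s i U)) 0"
  by (rule has_wirt_affine) (rule det_mult_shift_entry[OF assms])

lemma has_wirt_gen:
  assumes X: "X \<in> carrier_mat g n" and Y: "Y \<in> carrier_mat g n"
    and U: "U \<in> carrier_mat n g" and si: "s < n" "i < g"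
  shows "has_wirt (gen n g X Y) s i U
    (det (X * unit_col s i U) * cnj (det (Y * U))) (det (X * U) * cnj (det (Y * unit_col s i U)))"
proof -
  have "has_wirt (\<lambda>U. det (X * U) * cnj (det (Y * U))) s i U
    (det (X * unit_col s i U) * cnj (det (Y * U))) (det (X * U) * cnj (det (Y * unit_col s i U)))"
    using has_wirt_mult[OF has_wirt_det[OF X U si] has_wirt_cnj[OF has_wirt_det[OF Y U si]]] by simp
  then show ?thesis
    by (subst has_wirt_cong[of n g, OF _ U]) (simp add: gen_def)
qed

text \<open>Euler's identity column by column: both determinants are linear in each column, so each
  of the \<open>g\<close> columns contributes 2.\<close>

lemma weight_gen:
  assumes X: "X \<in> carrier_mat g n" and Y: "Y \<in> carrier_mat g n"
  shows "weight n g (gen n g X Y) = (\<lambda>U. (2 * of_nat g - of_nat n) * gen n g X Y U)"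
proof
  fix U
  show "weight n g (gen n g X Y) U = (2 * of_nat g - of_nat n) * gen n g X Y U"
  proof (cases "U \<in> carrier_mat n g")
    case U: True
    let ?a = "det (X * U)" and ?b = "det (Y * U)"
    have "(\<Sum>s<n. U $$ (s, i) * wirt s i (gen n g X Y) U)
        + (\<Sum>s<n. cnj (U $$ (s, i)) * wirt_bar s i (gen n g X Y) U) = 2 * (?a * cnj ?b)"
      if i: "i < g" for i
    proof -
      have "(\<Sum>s<n. U $$ (s, i) * wirt s i (gen n g X Y) U)
          = (\<Sum>s<n. U $$ (s, i) * det (X * unit_col s i U)) * cnj ?b"
        using i by (simp add: sum_distrib_right has_wirt_imp_wirt[OF has_wirt_gen[OF X Y U]] mult.assoc)
      moreover have "(\<Sum>s<n. cnj (U $$ (s, i)) * wirt_bar s i (gen n g X Y) U)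
          = ?a * cnj (\<Sum>s<n. U $$ (s, i) * det (Y * unit_col s i U))"
        using i by (simp add: sum_distrib_left has_wirt_imp_wirt_bar[OF has_wirt_gen[OF X Y U]] mult_ac)
      ultimately show ?thesis
        by (simp add: det_mult_unit_col[OF X U i, symmetric] det_mult_unit_col[OF Y U i, symmetric])
    qed
    then show ?thesis
      using U by (simp add: weight_def) (simp add: gen_def algebra_simps)
  qed (simp add: weight_def gen_def)
qed

lemma weight_\<F>: "P \<in> \<F> n g \<Longrightarrow> weight n g P = (\<lambda>U. (2 * of_nat g - of_nat n) * P U)"
proof (induction rule: \<F>_induct)
  case (comb P P' a b)
  then show ?case by (simp add: weight_comb algebra_simps)
qed (rule weight_gen)

section \<open>Bordered determinants and wedge products with a coordinate form\<close>

definition bordered :: "nat \<Rightarrow> (nat \<Rightarrow> complex) \<Rightarrow> complex mat \<Rightarrow> complex mat" where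
  "bordered g y M = mat (Suc g) (Suc g) (\<lambda>(r, c). if r = 0 then y c else M $$ (r - 1, c))"

text \<open>Laplace expansion along the border; since the border is row 0, the sign depends on the
  column \<open>k\<close> alone.\<close>

lemma det_bordered:
  assumes X: "X \<in> carrier_mat g n" and U: "U \<in> carrier_mat n (Suc g)"
  shows "det (bordered g y (X * U)) = (\<Sum>k<Suc g. (-1) ^ k * y k * det (X * delete_col k U))"
proof -
  have "mat_delete (bordered g y (X * U)) 0 k = X * delete_col k U" if "k < Suc g" for k
    unfolding mat_delete_def using that X U
    by (intro eq_matI)
      (auto simp: bordered_def delete_col_def scalar_prod_def intro!: sum.cong)
  then show ?thesis
    by (subst laplace_expansion_row[of _ "Suc g" 0])
      (auto simp: cofactor_def bordered_def mult_ac intro!: sum.cong)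
qed

text \<open>Border \<open>X * W\<close> by a row supported on the two equal columns.\<close>

lemma det_delete_equal_cols:
  assumes X: "X \<in> carrier_mat g n" and W: "W \<in> carrier_mat n (Suc g)"
    and ij: "i < Suc g" "j < Suc g" "i \<noteq> j"
    and eq: "\<And>s. s < n \<Longrightarrow> W $$ (s, i) = W $$ (s, j)"
  shows "det (X * delete_col i W) = - ((-1) ^ (i + j) * det (X * delete_col j W))"
proof -
  let ?B = "bordered g (\<lambda>c. if c = i \<or> c = j then 1 else 0) (X * W)"
  have "det ?B = 0"
  proof (rule det_identical_columns[of _ "Suc g" i j])
    have "(X * W) $$ (r, i) = (X * W) $$ (r, j)" if "r < g" for r
      using that ij eq by (simp add: mult_index_sum[OF X W] del: index_mult_mat)
    then show "col ?B i = col ?B j"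
      using ij by (intro eq_vecI) (auto simp: bordered_def)
  qed (use ij in \<open>auto simp: bordered_def\<close>)
  moreover have "det ?B = (\<Sum>k\<in>{i, j}. (-1) ^ k * det (X * delete_col k W))"
    unfolding det_bordered[OF X W] using ij by (intro sum.mono_neutral_cong_right) auto
  ultimately have "(-1) ^ i * det (X * delete_col i W) + (-1) ^ j * det (X * delete_col j W) = 0"
    using ij by simp
  then have "(-1) ^ i * ((-1) ^ i * det (X * delete_col i W) + (-1) ^ j * det (X * delete_col j W)) = 0"
    by simp
  then show ?thesis
    by (simp add: distrib_left power_add eq_neg_iff_add_eq_0 flip: mult.assoc power_mult_distrib)
qed

text \<open>For different \<open>i\<close> and \<open>j\<close>, the operator defining the
  coefficient substitutes column \<open>i\<close> for column \<open>j\<close> in the holomorphic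
  determinant. As column \<open>i\<close> has been deleted there, the result is, up to order, the
  determinant with column \<open>j\<close> deleted, and \<open>det_delete_equal_cols\<close>
  supplies the sign.\<close>

lemma m_coeff_gen:
  assumes X: "X \<in> carrier_mat g n" and Y: "Y \<in> carrier_mat g n" and U: "U \<in> carrier_mat n (Suc g)"
    and ij: "i < Suc g" "j < Suc g"
  shows "m_coeff n (gen n g X Y) i j U
    = (-1) ^ (i + j) * det (X * delete_col j U) * cnj (det (Y * delete_col i U))"
proof (cases "i = j")
  case True
  then show ?thesis using U by (simp add: m_coeff_def gen_def flip: mult_2)
next
  case False
  define j' where "j' = (if j < i then j else j - 1)"
  \<comment> \<open>\<open>U\<close> with column \<open>j\<close> overwritten by column
    \<open>i\<close>; once column \<open>i\<close> is deleted, the copy sits at position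
    \<open>j'\<close>.\<close>
  define W where "W = mat n (Suc g) (\<lambda>(s, c). if c = j then U $$ (s, i) else U $$ (s, c))"
  have j': "j' < g" using ij False by (auto simp: j'_def)
  have W: "W \<in> carrier_mat n (Suc g)" by (simp add: W_def)
  have "delete_col i W $$ (s, j') = U $$ (s, i)" if "s < n" for s
    using that ij j' False W by (auto simp: delete_col_def W_def j'_def)
  moreover have "unit_col s j' (delete_col i W) = unit_col s j' (delete_col i U)" for s
    using ij False U by (intro eq_matI) (auto simp: delete_col_def W_def j'_def unit_col_def)
  ultimately have "(\<Sum>s<n. U $$ (s, i) * det (X * unit_col s j' (delete_col i U)))
      = det (X * delete_col i W)"
    using det_mult_unit_col[OF X delete_col_carrier[OF W] j'] by simp
  also have "\<dots> = - ((-1) ^ (i + j) * det (X * delete_col j W))"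
    by (rule det_delete_equal_cols[OF X W ij False]) (use ij in \<open>simp add: W_def\<close>)
  also have "delete_col j W = delete_col j U"
    using ij U by (intro eq_matI) (auto simp: delete_col_def W_def)
  finally have *: "(\<Sum>s<n. U $$ (s, i) * det (X * unit_col s j' (delete_col i U)))
      = - ((-1) ^ (i + j) * det (X * delete_col j U))" .
  have "wirt s j (\<lambda>W. gen n g X Y (delete_col i W)) U
      = det (X * unit_col s j' (delete_col i U)) * cnj (det (Y * delete_col i U))" if "s < n" for s
    using has_wirt_imp_wirt[OF has_wirt_gen[OF X Y delete_col_carrier[OF U] that j']]
    by (simp add: wirt_delete_col[OF U ij False] flip: j'_def)
  then have "m_coeff n (gen n g X Y) i j U
      = - ((\<Sum>s<n. U $$ (s, i) * det (X * unit_col s j' (delete_col i U))) * cnj (det (Y * delete_col i U)))"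
    using False by (simp add: m_coeff_def sum_distrib_right mult.assoc)
  then show ?thesis by (simp add: *)
qed

text \<open>On \<open>det (X * U)\<close> this is \<open>\<epsilon>\<^sub>s\<close>, the wedge
  product from the left with the coordinate form \<open>s\<close>.\<close>

definition add_row :: "nat \<Rightarrow> complex mat \<Rightarrow> complex mat" where
  "add_row s X = mat (Suc (dim_row X)) (dim_col X)
     (\<lambda>(i, r). if i = 0 then (if r = s then 1 else 0) else X $$ (i - 1, r))"

definition drop_row :: "nat \<Rightarrow> complex mat \<Rightarrow> complex mat" where
  "drop_row i X = mat (dim_row X - 1) (dim_col X) (\<lambda>(r, c). X $$ (if r < i then r else Suc r, c))"

lemma add_row_carrier [simp]: "X \<in> carrier_mat g n \<Longrightarrow> add_row s X \<in> carrier_mat (Suc g) n"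
  by (auto simp: add_row_def)

lemma drop_row_carrier [simp]: "X \<in> carrier_mat (Suc g) n \<Longrightarrow> drop_row i X \<in> carrier_mat g n"
  by (auto simp: drop_row_def)

lemma det_add_row_mult:
  assumes X: "X \<in> carrier_mat g n" and U: "U \<in> carrier_mat n (Suc g)" and s: "s < n"
  shows "det (add_row s X * U) = (\<Sum>k<Suc g. (-1) ^ k * U $$ (s, k) * det (X * delete_col k U))"
proof -
  have A: "add_row s X \<in> carrier_mat (Suc g) n" using X by simp
  have "add_row s X * U = bordered g (\<lambda>k. U $$ (s, k)) (X * U)"
  proof (rule eq_matI)
    fix i j assume "i < dim_row (bordered g (\<lambda>k. U $$ (s, k)) (X * U))"
      "j < dim_col (bordered g (\<lambda>k. U $$ (s, k)) (X * U))"
    then have ij: "i < Suc g" "j < Suc g" by (auto simp: bordered_def)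
    show "(add_row s X * U) $$ (i, j) = bordered g (\<lambda>k. U $$ (s, k)) (X * U) $$ (i, j)"
      using ij s X unfolding mult_index_sum[OF A U ij]
      by (auto simp: bordered_def add_row_def if_distrib[of "\<lambda>a. a * _"] mult_index_sum[OF X U]
          simp del: index_mult_mat cong: if_cong)
  qed (use X U in \<open>auto simp: bordered_def add_row_def\<close>)
  then show ?thesis by (simp only: det_bordered[OF X U])
qed

text \<open>The sign \<open>(-1) ^ (k + l)\<close> of the coefficients and each summand of
  \<open>herm\<close> split into a factor in \<open>k\<close> and a factor in \<open>l\<close>. For
  fixed \<open>s\<close> the double sum is thus a product of two expansions along the added
  row.\<close>

lemma raise_gen:
  assumes X: "X \<in> carrier_mat g n" and Y: "Y \<in> carrier_mat g n"
  shows "raise n g (gen n g X Y) = (\<lambda>U. \<Sum>s<n. gen n (Suc g) (add_row s X) (add_row s Y) U)"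
proof
  fix U
  show "raise n g (gen n g X Y) U = (\<Sum>s<n. gen n (Suc g) (add_row s X) (add_row s Y) U)"
  proof (cases "U \<in> carrier_mat n (Suc g)")
    case U: True
    let ?a = "\<lambda>s k. (-1) ^ k * U $$ (s, k) * det (X * delete_col k U)"
    let ?b = "\<lambda>s k. (-1) ^ k * U $$ (s, k) * det (Y * delete_col k U)"
    have "raise n g (gen n g X Y) U = (\<Sum>k<Suc g. \<Sum>l<Suc g. \<Sum>s<n. ?a s k * cnj (?b s l))"
      using U unfolding raise_def on_mat_apply[OF U]
      by (intro sum.cong refl)
        (simp add: m_coeff_gen[OF X Y U] herm_def sum_distrib_left power_add mult_ac)
    also have "\<dots> = (\<Sum>k<Suc g. \<Sum>s<n. \<Sum>l<Suc g. ?a s k * cnj (?b s l))"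
      by (intro sum.cong refl sum.swap)
    also have "\<dots> = (\<Sum>s<n. \<Sum>k<Suc g. \<Sum>l<Suc g. ?a s k * cnj (?b s l))"
      by (rule sum.swap)
    also have "\<dots> = (\<Sum>s<n. (\<Sum>k<Suc g. ?a s k) * cnj (\<Sum>l<Suc g. ?b s l))"
      by (simp only: sum_product cnj_sum)
    also have "\<dots> = (\<Sum>s<n. gen n (Suc g) (add_row s X) (add_row s Y) U)"
      by (intro sum.cong refl)
        (simp only: gen_def on_mat_apply[OF U] det_add_row_mult[OF X U] det_add_row_mult[OF Y U] lessThan_iff)
    finally show ?thesis .
  qed (simp add: raise_def gen_def)
qed

section \<open>Lowering operator and commutation relations\<close>

text \<open>\<open>det (X * append_unit_col s V)\<close> is the contraction
  \<open>\<iota>\<^sub>s\<close> with the basis vector in the last slot. The last slot here against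
  the first row in \<open>add_row\<close> is the source of the signs
  \<open>(-1) ^ g\<close>.\<close>

definition append_unit_col :: "nat \<Rightarrow> complex mat \<Rightarrow> complex mat" where
  "append_unit_col s V = unit_col s (dim_col V) (append_zero_col V)"

lemma append_unit_col_carrier [simp]:
  "V \<in> carrier_mat n g \<Longrightarrow> append_unit_col s V \<in> carrier_mat n (Suc g)"
  by (simp add: append_unit_col_def)

lemma append_unit_col_index:
  "V \<in> carrier_mat n g \<Longrightarrow> r < n \<Longrightarrow> c < Suc g \<Longrightarrow>
    append_unit_col s V $$ (r, c) = (if c < g then V $$ (r, c) else if r = s then 1 else 0)"
  by (auto simp: append_unit_col_def unit_col_def append_zero_col_def)

text \<open>The two derivatives act on different factors, one holomorphic and one antiholomorphic,
  each linear in the last column.\<close>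

lemma last_laplacian_gen:
  assumes X: "X \<in> carrier_mat (Suc g) n" and Y: "Y \<in> carrier_mat (Suc g) n"
    and U: "U \<in> carrier_mat n (Suc g)"
  shows "last_laplacian n g (gen n (Suc g) X Y) U
    = (\<Sum>s<n. det (X * unit_col s g U) * cnj (det (Y * unit_col s g U)))"
  unfolding last_laplacian_def
proof (intro sum.cong refl)
  fix s assume "s \<in> {..<n}"
  then have s: "s < n" by simp
  have "wirt s g (wirt_bar s g (gen n (Suc g) X Y)) U
      = wirt s g (\<lambda>V. det (X * V) * cnj (det (Y * unit_col s g V))) U"
    by (rule wirt_cong[OF _ U]) (simp add: has_wirt_imp_wirt_bar[OF has_wirt_gen[OF X Y _ s]])
  \<comment> \<open>Overwriting column \<open>g\<close> by a basis vector makes this factor constant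
    in that column.\<close>
  also have "has_wirt (\<lambda>V. cnj (det (Y * unit_col s g V))) s g U 0 0"
    by (rule has_wirt_affine) simp
  then have "wirt s g (\<lambda>V. det (X * V) * cnj (det (Y * unit_col s g V))) U
      = det (X * unit_col s g U) * cnj (det (Y * unit_col s g U))"
    using has_wirt_imp_wirt[OF has_wirt_mult[OF has_wirt_det[OF X U s]]] by simp
  finally show "wirt s g (wirt_bar s g (gen n (Suc g) X Y)) U
      = det (X * unit_col s g U) * cnj (det (Y * unit_col s g U))" .
qed

lemma lower_gen:
  assumes X: "X \<in> carrier_mat (Suc g) n" and Y: "Y \<in> carrier_mat (Suc g) n"
  shows "lower n g (gen n (Suc g) X Y)
    = on_mat n g (\<lambda>V. \<Sum>s<n. det (X * append_unit_col s V) * cnj (det (Y * append_unit_col s V)))"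
  unfolding lower_def
  by (rule on_mat_eqI) (auto simp: last_laplacian_gen[OF X Y] append_unit_col_def)

text \<open>On generators the last column is overwritten in both determinants. This is the
  independence of the last column that justifies evaluating \<open>lower\<close> at a zero
  column.\<close>

lemma last_laplacian_eq_lower:
  assumes "P \<in> \<F> n (Suc g)" and U: "U \<in> carrier_mat n (Suc g)"
  shows "last_laplacian n g P U = lower n g P (delete_col g U)"
  using assms(1)
proof (induction rule: \<F>_induct)
  case (gen X Y)
  have "unit_col s g U = append_unit_col s (delete_col g U)" for s
    using U by (intro eq_matI)
      (auto simp: unit_col_def append_unit_col_def append_zero_col_def delete_col_def)
  then show ?case
    using U by (simp add: lower_gen[OF gen] last_laplacian_gen[OF gen])
next
  case (comb P P' a b)
  then show ?case using U by (simp add: lower_comb last_laplacian_comb)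
qed

text \<open>Laplace expansion along the last column of the product, which is column \<open>s\<close>
  of \<open>X\<close>.\<close>

lemma det_mult_append_unit_col:
  assumes X: "X \<in> carrier_mat (Suc g) n" and V: "V \<in> carrier_mat n g" and s: "s < n"
  shows "det (X * append_unit_col s V) = (\<Sum>i<Suc g. (-1) ^ (i + g) * X $$ (i, s) * det (drop_row i X * V))"
proof -
  let ?W = "append_unit_col s V"
  have W: "?W \<in> carrier_mat n (Suc g)" using V by simp
  have "(X * ?W) $$ (i, g) = X $$ (i, s)" if "i < Suc g" for i
    using that s V by (simp add: mult_index_sum[OF X W] append_unit_col_index
        if_distrib[of "(*) _"] del: index_mult_mat cong: if_cong)
  moreover have "mat_delete (X * ?W) i g = drop_row i X * V" if "i < Suc g" for i
    unfolding mat_delete_def using that X V W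
    by (intro eq_matI)
      (auto simp: carrier_matD[OF W] drop_row_def scalar_prod_def append_unit_col_index intro!: sum.cong)
  ultimately show ?thesis
    by (subst laplace_expansion_column[OF mult_carrier_mat[OF X W], of g])
      (auto simp: cofactor_def mult_ac intro!: sum.cong)
qed

section \<open>Finite linear combinations and stability of the spaces under raising and
  lowering\<close>

lemma \<F>_zero: "(\<lambda>U. 0) \<in> \<F> n g"
  using \<F>_comb[OF gen_in_\<F> gen_in_\<F>, of "0\<^sub>m g n" g n "0\<^sub>m g n" "0\<^sub>m g n" "0\<^sub>m g n" 0 0] by simp

lemma \<F>_lincomb:
  assumes "\<And>i. i \<in> I \<Longrightarrow> f i \<in> \<F> n g"
  shows "(\<lambda>U. \<Sum>i\<in>I. c i * f i U) \<in> \<F> n g"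
  using assms
proof (induction I rule: infinite_finite_induct)
  case (insert i I)
  then show ?case using \<F>_comb[of "f i" n g "\<lambda>U. \<Sum>i\<in>I. c i * f i U" "c i" 1] by simp
qed (simp_all add: \<F>_zero)

lemma \<F>_sum: "(\<And>i. i \<in> I \<Longrightarrow> f i \<in> \<F> n g) \<Longrightarrow> (\<lambda>U. \<Sum>i\<in>I. f i U) \<in> \<F> n g"
  using \<F>_lincomb[of I f n g "\<lambda>_. 1"] by simp

lemma raise_lincomb:
  assumes "\<And>i. i \<in> I \<Longrightarrow> f i \<in> \<F> n g"
  shows "raise n g (\<lambda>U. \<Sum>i\<in>I. c i * f i U) = (\<lambda>U. \<Sum>i\<in>I. c i * raise n g (f i) U)"
  using assms
proof (induction I rule: infinite_finite_induct)
  case (insert i I)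
  then show ?case
    using raise_comb[of "f i" n g "\<lambda>U. \<Sum>i\<in>I. c i * f i U" "c i" 1] by (simp add: \<F>_lincomb)
qed (use raise_comb[OF \<F>_zero \<F>_zero, of n g 0 0] in simp_all)

lemma lower_lincomb:
  assumes "\<And>i. i \<in> I \<Longrightarrow> f i \<in> \<F> n (Suc g)"
  shows "lower n g (\<lambda>U. \<Sum>i\<in>I. c i * f i U) = (\<lambda>U. \<Sum>i\<in>I. c i * lower n g (f i) U)"
  using assms
proof (induction I rule: infinite_finite_induct)
  case (insert i I)
  then show ?case
    using lower_comb[of "f i" n g "\<lambda>U. \<Sum>i\<in>I. c i * f i U" "c i" 1] by (simp add: \<F>_lincomb)
qed (use lower_comb[OF \<F>_zero \<F>_zero, of n g 0 0] in simp_all)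

lemma raise_in_\<F>: "P \<in> \<F> n g \<Longrightarrow> raise n g P \<in> \<F> n (Suc g)"
proof (induction rule: \<F>_induct)
  case (gen X Y)
  then show ?case by (simp add: raise_gen \<F>_sum gen_in_\<F>)
next
  case (comb P P' a b)
  then show ?case by (simp add: raise_comb \<F>_comb)
qed

text \<open>Expanding the contractions by rows writes the result in generators of degree
  \<open>g\<close>, which yields membership and a form to which \<open>raise_gen\<close>
  applies.\<close>

lemma lower_gen_lincomb:
  assumes X: "X \<in> carrier_mat (Suc g) n" and Y: "Y \<in> carrier_mat (Suc g) n"
  shows "lower n g (gen n (Suc g) X Y)
    = (\<lambda>V. \<Sum>(s, i, j) \<in> {..<n} \<times> {..<Suc g} \<times> {..<Suc g}.
        (-1) ^ (i + g) * X $$ (i, s) * cnj ((-1) ^ (j + g) * Y $$ (j, s))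
        * gen n g (drop_row i X) (drop_row j Y) V)"
proof
  fix V
  show "lower n g (gen n (Suc g) X Y) V
    = (\<Sum>(s, i, j) \<in> {..<n} \<times> {..<Suc g} \<times> {..<Suc g}.
        (-1) ^ (i + g) * X $$ (i, s) * cnj ((-1) ^ (j + g) * Y $$ (j, s))
        * gen n g (drop_row i X) (drop_row j Y) V)"
  proof (cases "V \<in> carrier_mat n g")
    case V: True
    show ?thesis
      unfolding lower_gen[OF X Y] on_mat_apply[OF V]
      by (simp only: sum.cartesian_product[symmetric], intro sum.cong refl)
        (simp add: det_mult_append_unit_col[OF X V] det_mult_append_unit_col[OF Y V]
          sum_product gen_def V mult_ac del: sum.lessThan_Suc)
  qed (simp add: lower_def gen_def case_prod_beta)
qed

lemma lower_in_\<F>: "P \<in> \<F> n (Suc g) \<Longrightarrow> lower n g P \<in> \<F> n g"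
proof (induction rule: \<F>_induct)
  case (gen X Y)
  then show ?case
    unfolding lower_gen_lincomb[OF gen] case_prod_beta by (intro \<F>_lincomb gen_in_\<F>) auto
next
  case (comb P P' a b)
  then show ?case by (simp add: lower_comb \<F>_comb)
qed

text \<open>The value at \<open>U\<close> of \<open>\<epsilon>\<^sub>r \<iota>\<^sub>s f\<close> for \<open>f(U) = det (X * U)\<close>.\<close>

definition exchange :: "nat \<Rightarrow> nat \<Rightarrow> nat \<Rightarrow> complex mat \<Rightarrow> complex mat \<Rightarrow> complex" where
  "exchange g s r X U =
     (\<Sum>k<g. (-1) ^ k * U $$ (r, k) * det (X * delete_col k (append_unit_col s U)))"

text \<open>The relation \<open>\<iota>\<^sub>s \<epsilon>\<^sub>r = (-1)\<^sup>g
  \<delta>\<^sub>r\<^sub>s + \<epsilon>\<^sub>r \<iota>\<^sub>s\<close>: in the expansion along the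
  added row, the appended column gives the delta term and the columns of \<open>U\<close> give
  \<open>exchange\<close>.\<close>

lemma det_add_row_append_unit_col:
  assumes X: "X \<in> carrier_mat g n" and U: "U \<in> carrier_mat n g" and "r < n" "s < n"
  shows "det (add_row r X * append_unit_col s U)
    = (if r = s then (-1) ^ g * det (X * U) else 0) + exchange g s r X U"
proof -
  have W: "append_unit_col s U \<in> carrier_mat n (Suc g)" using U by simp
  have "delete_col g (append_unit_col s U) = U"
    using U by (intro eq_matI) (auto simp: carrier_matD[OF W] delete_col_def append_unit_col_index)
  then show ?thesis
    using assms by (simp add: det_add_row_mult[OF X W] append_unit_col_index exchange_def)
qed

text \<open>For fixed \<open>k\<close>, the sum over \<open>s\<close> puts column \<open>k\<close>
  of \<open>U\<close> into the last slot in place of position \<open>k\<close>. Moving it back costs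
  a sign, and all \<open>g\<close> values of \<open>k\<close> contribute equally.\<close>

lemma sum_exchange:
  assumes X: "X \<in> carrier_mat g n" and U: "U \<in> carrier_mat n g"
  shows "(\<Sum>s<n. exchange g s s X U) = - ((-1) ^ g * of_nat g * det (X * U))"
proof -
  have "(\<Sum>s<n. (-1) ^ k * U $$ (s, k) * det (X * delete_col k (append_unit_col s U)))
      = - ((-1) ^ g * det (X * U))" if k: "k < g" for k
  proof -
    \<comment> \<open>\<open>U\<close> with a second copy of column \<open>k\<close> appended;
      deleting position \<open>k\<close> leaves that copy at index \<open>g - 1\<close>, deleting
      position \<open>g\<close> gives back \<open>U\<close>.\<close>
    define W where "W = mat n (Suc g) (\<lambda>(s, c). if c < g then U $$ (s, c) else U $$ (s, k))"
    have W: "W \<in> carrier_mat n (Suc g)" by (simp add: W_def)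
    have "unit_col s (g - 1) (delete_col k W) = delete_col k (append_unit_col s U)" for s
      using U k by (intro eq_matI)
        (auto simp: W_def delete_col_def unit_col_def append_unit_col_def append_zero_col_def)
    moreover have "delete_col k W $$ (s, g - 1) = U $$ (s, k)" if "s < n" for s
      using that k by (auto simp: W_def delete_col_def)
    ultimately have "(\<Sum>s<n. U $$ (s, k) * det (X * delete_col k (append_unit_col s U)))
        = det (X * delete_col k W)"
      using det_mult_unit_col[OF X delete_col_carrier[OF W], of "g - 1" k] k by simp
    also have "\<dots> = - ((-1) ^ (k + g) * det (X * delete_col g W))"
      by (rule det_delete_equal_cols[OF X W]) (use k in \<open>auto simp: W_def\<close>)
    also have "delete_col g W = U"
      using U by (intro eq_matI) (auto simp: W_def delete_col_def)
    finally have "(-1) ^ k * (\<Sum>s<n. U $$ (s, k) * det (X * delete_col k (append_unit_col s U)))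
        = - ((-1) ^ g * det (X * U))"
      by (simp add: power_add flip: mult.assoc power_mult_distrib)
    then show ?thesis by (simp add: sum_distrib_left mult.assoc)
  qed
  then show ?thesis
    unfolding exchange_def by (subst sum.swap) simp
qed

text \<open>In the product of two relations for \<open>\<iota>\<^sub>s \<epsilon>\<^sub>r\<close>
  the delta terms sum to \<open>n\<close>, each of the two mixed terms sums to \<open>-g\<close> by
  \<open>sum_exchange\<close>, and the product of the exchange terms remains.\<close>

lemma lower_raise_gen:
  assumes X: "X \<in> carrier_mat g n" and Y: "Y \<in> carrier_mat g n" and U: "U \<in> carrier_mat n g"
  shows "lower n g (raise n g (gen n g X Y)) U = (of_nat n - 2 * of_nat g) * gen n g X Y U
    + (\<Sum>r<n. \<Sum>s<n. exchange g s r X U * cnj (exchange g s r Y U))"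
proof -
  let ?e = "(-1) ^ g :: complex" and ?a = "det (X * U)" and ?b = "det (Y * U)"
  let ?J = "\<lambda>r s. exchange g s r X U" and ?K = "\<lambda>r s. exchange g s r Y U"
  have "lower n g (raise n g (gen n g X Y)) U
      = (\<Sum>r<n. \<Sum>s<n. det (add_row r X * append_unit_col s U) * cnj (det (add_row r Y * append_unit_col s U)))"
    using lower_lincomb[of "{..<n}" "\<lambda>s. gen n (Suc g) (add_row s X) (add_row s Y)" n g "\<lambda>_. 1"] X Y U
    by (simp add: raise_gen gen_in_\<F> lower_gen)
  also have "\<dots> = (\<Sum>r<n. \<Sum>s<n. ?J r s * cnj (?K r s)
      + (if s = r then ?a * cnj ?b + ?e * ?a * cnj (?K r r) + ?e * cnj ?b * ?J r r else 0))"
    by (intro sum.cong refl)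
      (auto simp: det_add_row_append_unit_col[OF X U] det_add_row_append_unit_col[OF Y U]
        algebra_simps simp flip: power_mult_distrib)
  also have "\<dots> = (\<Sum>r<n. \<Sum>s<n. ?J r s * cnj (?K r s))
      + (of_nat n * (?a * cnj ?b) + ?e * ?a * cnj (\<Sum>r<n. ?K r r) + ?e * cnj ?b * (\<Sum>r<n. ?J r r))"
    by (simp add: sum.distrib sum_distrib_left)
  also have "\<dots> = (\<Sum>r<n. \<Sum>s<n. ?J r s * cnj (?K r s)) + (of_nat n - 2 * of_nat g) * (?a * cnj ?b)"
    unfolding sum_exchange[OF X U] sum_exchange[OF Y U]
    by (simp add: algebra_simps flip: power_mult_distrib)
  finally show ?thesis using U by (simp add: gen_def)
qed

text \<open>Contracting first and wedging afterwards gives exactly the exchange terms, so this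
  double sum cancels the one in \<open>lower_raise_gen\<close> taken at degree
  \<open>Suc g\<close>.\<close>

lemma raise_lower_gen:
  assumes X: "X \<in> carrier_mat (Suc g) n" and Y: "Y \<in> carrier_mat (Suc g) n"
    and U: "U \<in> carrier_mat n (Suc g)"
  shows "raise n g (lower n g (gen n (Suc g) X Y)) U
    = (\<Sum>r<n. \<Sum>s<n. exchange (Suc g) s r X U * cnj (exchange (Suc g) s r Y U))"
proof -
  let ?c = "\<lambda>X s i. (-1) ^ (i + g) * (X :: complex mat) $$ (i, s)"
  have exchange: "exchange (Suc g) s r Z U = (\<Sum>i<Suc g. ?c Z s i * det (add_row r (drop_row i Z) * U))"
    if Z: "Z \<in> carrier_mat (Suc g) n" and "r < n" "s < n" for Z r s
  proof -
    \<comment> \<open>The appended column is last, so deleting an earlier column commutes with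
      appending; the expansions along the added row and the appended column can then be
      interchanged.\<close>
    have "delete_col k (append_unit_col s U) = append_unit_col s (delete_col k U)" if "k < Suc g" for k
      using U that by (intro eq_matI)
        (auto simp: delete_col_def append_unit_col_def unit_col_def append_zero_col_def)
    then have "exchange (Suc g) s r Z U
        = (\<Sum>k<Suc g. (-1) ^ k * U $$ (r, k) * (\<Sum>i<Suc g. ?c Z s i * det (drop_row i Z * delete_col k U)))"
      unfolding exchange_def
      by (intro sum.cong refl)
        (simp add: det_mult_append_unit_col[OF Z delete_col_carrier[OF U] \<open>s < n\<close>] del: sum.lessThan_Suc)
    also have "\<dots> = (\<Sum>k<Suc g. \<Sum>i<Suc g. ?c Z s i * ((-1) ^ k * U $$ (r, k) * det (drop_row i Z * delete_col k U)))"
      by (simp add: sum_distrib_left mult_ac del: sum.lessThan_Suc)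
    also have "\<dots> = (\<Sum>i<Suc g. ?c Z s i * det (add_row r (drop_row i Z) * U))"
      by (subst sum.swap)
        (simp add: det_add_row_mult[OF drop_row_carrier[OF Z] U \<open>r < n\<close>] sum_distrib_left
          del: sum.lessThan_Suc)
    finally show ?thesis .
  qed
  have "raise n g (lower n g (gen n (Suc g) X Y)) U
      = (\<Sum>(s, i, j) \<in> {..<n} \<times> {..<Suc g} \<times> {..<Suc g}. ?c X s i * cnj (?c Y s j)
          * raise n g (gen n g (drop_row i X) (drop_row j Y)) U)"
    unfolding lower_gen_lincomb[OF X Y] case_prod_beta
    by (subst raise_lincomb) (auto intro!: gen_in_\<F> drop_row_carrier X Y)
  also have "\<dots> = (\<Sum>s<n. \<Sum>i<Suc g. \<Sum>j<Suc g. \<Sum>r<n. ?c X s i * cnj (?c Y s j) *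
      (det (add_row r (drop_row i X) * U) * cnj (det (add_row r (drop_row j Y) * U))))"
    by (simp only: sum.cartesian_product[symmetric]
        raise_gen[OF drop_row_carrier[OF X] drop_row_carrier[OF Y]])
      (simp add: gen_def U sum_distrib_left del: sum.lessThan_Suc)
  also have "\<dots> = (\<Sum>s<n. \<Sum>i<Suc g. \<Sum>r<n. \<Sum>j<Suc g. ?c X s i * cnj (?c Y s j) *
      (det (add_row r (drop_row i X) * U) * cnj (det (add_row r (drop_row j Y) * U))))"
    by (intro sum.cong refl sum.swap)
  also have "\<dots> = (\<Sum>s<n. \<Sum>r<n. \<Sum>i<Suc g. \<Sum>j<Suc g. ?c X s i * cnj (?c Y s j) *
      (det (add_row r (drop_row i X) * U) * cnj (det (add_row r (drop_row j Y) * U))))"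
    by (intro sum.cong refl sum.swap)
  also have "\<dots> = (\<Sum>s<n. \<Sum>r<n. exchange (Suc g) s r X U * cnj (exchange (Suc g) s r Y U))"
    by (intro sum.cong refl)
      (simp add: exchange[OF X] exchange[OF Y] sum_product mult_ac del: sum.lessThan_Suc)
  finally show ?thesis by (subst sum.swap)
qed

text \<open>On generators the exchange sums cancel and the scalar \<open>2 (g + 1) - n\<close>
  remains, which is that of \<open>weight_gen\<close>.\<close>

lemma raise_lower_comm:
  assumes "P \<in> \<F> n (Suc g)"
  shows "raise n g (lower n g P) U - lower n (Suc g) (raise n (Suc g) P) U = weight n (Suc g) P U"
  using assms
proof (induction rule: \<F>_induct)
  case (gen X Y)
  show ?case
  proof (cases "U \<in> carrier_mat n (Suc g)")
    case True
    then show ?thesis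
      using gen by (simp only: raise_lower_gen lower_raise_gen weight_gen) (simp add: algebra_simps)
  qed (simp add: raise_def lower_def weight_def)
next
  case (comb P P' a b)
  have "a * (raise n g (lower n g P) U - lower n (Suc g) (raise n (Suc g) P) U)
      + b * (raise n g (lower n g P') U - lower n (Suc g) (raise n (Suc g) P') U)
      = a * weight n (Suc g) P U + b * weight n (Suc g) P' U"
    by (simp only: comb.IH)
  then show ?case
    using comb.hyps
    by (simp add: raise_comb lower_comb weight_comb raise_in_\<F> lower_in_\<F>)
      (simp add: algebra_simps)
qed

text \<open>Degree 0 is separate because lowering out of it is 0 by convention; there the exchange
  sum is empty.\<close>

lemma lower_raise_0:
  assumes "P \<in> \<F> n 0"
  shows "- lower n 0 (raise n 0 P) U = weight n 0 P U"
  using assms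
proof (induction rule: \<F>_induct)
  case (gen X Y)
  show ?case
  proof (cases "U \<in> carrier_mat n 0")
    case True
    then show ?thesis
      using gen by (simp only: lower_raise_gen weight_gen) (simp add: exchange_def)
  qed (simp add: lower_def weight_def)
next
  case (comb P P' a b)
  have "a * - lower n 0 (raise n 0 P) U + b * - lower n 0 (raise n 0 P') U
      = a * weight n 0 P U + b * weight n 0 P' U"
    by (simp only: comb.IH)
  then show ?case
    using comb.hyps by (simp add: raise_comb lower_comb weight_comb raise_in_\<F>)
qed

text \<open>Padding \<open>Z\<close> and \<open>U\<close> to square matrices shows that a product through a space of smaller
  dimension is singular.\<close>

lemma det_mult_eq_0:
  assumes Z: "Z \<in> carrier_mat (Suc n) n" and U: "U \<in> carrier_mat n (Suc n)"
  shows "det (Z * U :: complex mat) = 0"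
proof -
  define Z' where "Z' = mat (Suc n) (Suc n) (\<lambda>(i, r). if r < n then Z $$ (i, r) else 0)"
  define U' where "U' = mat (Suc n) (Suc n) (\<lambda>(r, j). if r < n then U $$ (r, j) else 0)"
  have carr: "Z' \<in> carrier_mat (Suc n) (Suc n)" "U' \<in> carrier_mat (Suc n) (Suc n)"
    by (auto simp: Z'_def U'_def)
  have "Z * U = Z' * U'"
    using Z U by (intro eq_matI) (auto simp: Z'_def U'_def scalar_prod_def)
  moreover have "det U' = 0"
    by (subst laplace_expansion_row[OF carr(2), of n]) (auto simp: U'_def)
  ultimately show ?thesis by (simp add: det_mult[OF carr])
qed

text \<open>Makes the convention that raising out of degree \<open>n\<close> gives 0 agree with the
  formula for \<open>raise\<close>.\<close>

lemma \<F>_Suc_self: "P \<in> \<F> n (Suc n) \<Longrightarrow> P = (\<lambda>U. 0)"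
proof (induction rule: \<F>_induct)
  case (gen X Y)
  then show ?case by (auto simp: gen_def on_mat_def det_mult_eq_0)
qed auto

section \<open>Operators on the direct sum, with truncation at degree \<open>n\<close>\<close>

lemma \<F>sum_D: "P \<in> \<F>sum n \<Longrightarrow> g \<le> n \<Longrightarrow> P g \<in> \<F> n g"
  "P \<in> \<F>sum n \<Longrightarrow> \<not> g \<le> n \<Longrightarrow> P g = (\<lambda>U. 0)"
  by (auto simp: \<F>sum_def)

lemma weight_zero: "weight n g (\<lambda>U. 0) = (\<lambda>U. 0)"
  using weight_\<F>[OF \<F>_zero] by simp

lemma Lambda_op_Suc: "Lambda_op n P (Suc g) = (if g < n then raise n g (P g) else (\<lambda>U. 0))"
  by (simp add: Lambda_op_def)

lemma Lambda_op_0: "Lambda_op n P 0 = (\<lambda>U. 0)"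
  by (simp add: Lambda_op_def)

lemma H_op_\<F>sum: "P \<in> \<F>sum n \<Longrightarrow> H_op n P g = (\<lambda>U. (2 * of_nat g - of_nat n) * P g U)"
  by (cases "g \<le> n") (simp_all add: H_op_def weight_\<F> weight_zero \<F>sum_D)

lemma Lambda_op_\<F>sum: "P \<in> \<F>sum n \<Longrightarrow> Lambda_op n P \<in> \<F>sum n"
  by (auto simp: \<F>sum_def Lambda_op_def \<F>_zero raise_in_\<F> split: nat.split)

lemma Delta_op_\<F>sum: "P \<in> \<F>sum n \<Longrightarrow> Delta_op n P \<in> \<F>sum n"
  by (auto simp: \<F>sum_def Delta_op_def \<F>_zero lower_in_\<F>)

lemma H_op_in_\<F>sum: "P \<in> \<F>sum n \<Longrightarrow> H_op n P \<in> \<F>sum n"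
  using \<F>_comb[of _ n _ _ _ 0] by (auto simp: H_op_\<F>sum \<F>sum_def)

lemma linear_Lambda_op: "linear_operator n (Lambda_op n)"
  unfolding linear_operator_def
proof (intro conjI ballI allI ext)
  fix P Q a b g U assume "P \<in> \<F>sum n" "Q \<in> \<F>sum n"
  then show "Lambda_op n (\<lambda>g U. a * P g U + b * Q g U) g U
      = a * Lambda_op n P g U + b * Lambda_op n Q g U"
    by (cases g) (simp_all add: Lambda_op_0 Lambda_op_Suc raise_comb \<F>sum_D)
qed (rule Lambda_op_\<F>sum)

lemma linear_Delta_op: "linear_operator n (Delta_op n)"
  unfolding linear_operator_def
proof (intro conjI ballI allI ext)
  fix P Q a b g U assume "P \<in> \<F>sum n" "Q \<in> \<F>sum n"
  then show "Delta_op n (\<lambda>g U. a * P g U + b * Q g U) g U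
      = a * Delta_op n P g U + b * Delta_op n Q g U"
    by (simp add: Delta_op_def lower_comb \<F>sum_D)
qed (rule Delta_op_\<F>sum)

lemma linear_H_op: "linear_operator n (H_op n)"
  unfolding linear_operator_def
proof (intro conjI ballI allI ext)
  fix P Q a b g U assume "P \<in> \<F>sum n" "Q \<in> \<F>sum n"
  then show "H_op n (\<lambda>g U. a * P g U + b * Q g U) g U = a * H_op n P g U + b * H_op n Q g U"
    by (cases "g \<le> n") (simp_all add: H_op_def weight_comb weight_zero \<F>sum_D)
qed (rule H_op_in_\<F>sum)

lemma commutator_Lambda_Delta:
  assumes P: "P \<in> \<F>sum n"
  shows "commutator (Lambda_op n) (Delta_op n) P = H_op n P"
proof (intro ext)
  fix g U
  \<comment> \<open>At \<open>g = n\<close> the truncated composition is 0, and so is the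
    untruncated one, because \<open>raise\<close> lands in the zero space
    \<open>\<F> n (Suc n)\<close>.\<close>
  have Delta_Lambda: "Delta_op n (Lambda_op n P) g = lower n g (raise n g (P g))" if "g \<le> n"
  proof (cases "g = n")
    case True
    then have "raise n g (P g) = (\<lambda>U. 0)"
      using \<F>sum_D(1)[OF P that] by (auto intro: \<F>_Suc_self raise_in_\<F>)
    then show ?thesis
      using True lower_comb[OF \<F>_zero \<F>_zero, of n g 0 0] by (simp add: Delta_op_def)
  qed (use that in \<open>simp add: Delta_op_def Lambda_op_Suc\<close>)
  show "commutator (Lambda_op n) (Delta_op n) P g U = H_op n P g U"
  proof (cases "g \<le> n")
    case True
    note Pg = \<F>sum_D(1)[OF P True]
    show ?thesis
    proof (cases g)
      case 0
      then show ?thesis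
        using Delta_Lambda[OF True] lower_raise_0[of "P g" n U] Pg
        by (simp add: commutator_def Lambda_op_0 H_op_def)
    next
      case (Suc h)
      then show ?thesis
        using Delta_Lambda[OF True] raise_lower_comm[of "P g" n h U] Pg True
        by (simp add: commutator_def Lambda_op_Suc Delta_op_def[of n P] H_op_def)
    qed
  next
    case False
    then obtain h where "g = Suc h" "\<not> h < n" by (cases g) auto
    then show ?thesis
      using False P by (simp add: commutator_def Lambda_op_Suc Delta_op_def H_op_\<F>sum \<F>sum_D(2))
  qed
qed

text \<open>\<open>H_op\<close> is the scalar \<open>2 g - n\<close> in degree \<open>g\<close>, and
  raising shifts the degree by one, so the scalars before and after differ by 2.\<close>

lemma commutator_H_Lambda:
  assumes P: "P \<in> \<F>sum n"
  shows "commutator (H_op n) (Lambda_op n) P = (\<lambda>g U. 2 * Lambda_op n P g U)"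
proof (intro ext)
  fix g U
  have "Lambda_op n (H_op n P) g U = (2 * of_nat g - 2 - of_nat n) * Lambda_op n P g U"
  proof (cases g)
    case (Suc h)
    then show ?thesis
      \<comment> \<open>The second coefficient 0 specialises additivity to compatibility with
        scalars.\<close>
      using raise_comb[of "P h" n h "P h" "2 * of_nat h - of_nat n" 0] \<F>sum_D(1)[OF P, of h]
      by (simp add: Lambda_op_Suc H_op_\<F>sum[OF P])
  qed (simp add: Lambda_op_0)
  then show "commutator (H_op n) (Lambda_op n) P g U = 2 * Lambda_op n P g U"
    by (simp add: commutator_def H_op_\<F>sum[OF Lambda_op_\<F>sum[OF P]] algebra_simps)
qed

lemma commutator_H_Delta:
  assumes P: "P \<in> \<F>sum n"
  shows "commutator (H_op n) (Delta_op n) P = (\<lambda>g U. - 2 * Delta_op n P g U)"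
proof (intro ext)
  fix g U
  have "Delta_op n (H_op n P) g U = (2 * of_nat g + 2 - of_nat n) * Delta_op n P g U"
    using lower_comb[of "P (Suc g)" n g "P (Suc g)" "2 * of_nat (Suc g) - of_nat n" 0]
      \<F>sum_D(1)[OF P, of "Suc g"]
    by (simp add: Delta_op_def H_op_\<F>sum[OF P] add.commute)
  then show "commutator (H_op n) (Delta_op n) P g U = - 2 * Delta_op n P g U"
    by (simp add: commutator_def H_op_\<F>sum[OF Delta_op_\<F>sum[OF P]] algebra_simps)
qed

theorem theorem2p9:
  fixes n :: nat
  shows "(\<forall>g<n. \<forall>P \<in> \<F> n (Suc g). \<forall>U \<in> carrier_mat n (Suc g).
            last_laplacian n g P U = lower n g P (delete_col g U)) \<and>
         linear_operator n (Lambda_op n) \<and>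
         linear_operator n (Delta_op n) \<and>
         linear_operator n (H_op n) \<and>
         (\<forall>P \<in> \<F>sum n.
            commutator (Lambda_op n) (Delta_op n) P = H_op n P \<and>
            commutator (H_op n) (Lambda_op n) P = (\<lambda>g U. 2 * Lambda_op n P g U) \<and>
            commutator (H_op n) (Delta_op n) P = (\<lambda>g U. - 2 * Delta_op n P g U))"
  using last_laplacian_eq_lower linear_Lambda_op linear_Delta_op linear_H_op
    commutator_Lambda_Delta commutator_H_Lambda commutator_H_Delta by simp

end
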